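(* Let $V$ be a complex vector space with $\dim V=k$ equipped with a nondegenerate symmetric bilinear form $b$, and let $\mathrm{O}(V)$ be its orthogonal group. The space $(V^{\otimes n})^{\mathrm{O}(V)}$ is nonzero if and only if $n$ is even. In this case, a basis for $(V^{\otimes n})^{\mathrm{O}(V)}$ is given by the set of 1-regular arc diagrams on $n$ vertices whose arcs can be decomposed into at most $k$ weak nestings. Here, identifying $V^{\otimes n}$ with the space of multilinear forms on $V^n$, each arc $(i,j)$ is interpreted as the contraction $f_{ij}$, and a diagram as the product of its arcs.
   Context: For $1\le i\le j\le n$, $f_{ij}(v_1,\dots,v_n)=b(v_i,v_j)$. An arc diagram on $n$ vertices is a multigraph on vertices $1,\dots,n$, with each edge (arc) written as a pair $(i,j)$ with $i\le j$; it is 1-regular if every vertex has degree 1 (so there are no loops or multiple edges). A weak nesting is a set of arcs that are pairwise weakly nested, where $(i,j)$ and $(i',j')$ are weakly nested if $i\le i'\le j'\le j$ or $i'\le i\le j\le j'$. The identification of $V^{\otimes n}$ with multilinear forms on $V^n$ uses $V\cong V^*$ via $b$.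
   Formalization: The claim that the space is nonzero if and only if n is even is stated for k at least 1, since for k = 0 and n = 2 the tensor power is zero although n is even; the basis claim is stated for every k. *)

theory Defs
  imports
    Complex_Main
    "HOL-Library.Multiset"
    "HOL-Library.FuncSet"
    "HOL-Library.Disjoint_Sets"
    "HOL-Library.Function_Algebras"
begin

section \<open>The space and its orthogonal group\<close>

text \<open>Linearity of \<open>b\<close> in the first argument follows from symmetry.\<close>

locale symmetric_bilinear_space = vector_space scale
  for scale :: "complex \<Rightarrow> 'v::ab_group_add \<Rightarrow> 'v"  (infixr \<open>*s\<close> 75) +
  fixes b :: "'v \<Rightarrow> 'v \<Rightarrow> complex"
  assumes finite_dim: "\<exists>B. finite B \<and> span B = UNIV"
    and linear_right: "Vector_Spaces.linear (*s) (*) (b x)"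
    and symmetric: "b x y = b y x"
    and nondegenerate: "(\<And>y. b x y = 0) \<Longrightarrow> x = 0"

definition orthogonal_group ::
    "(complex \<Rightarrow> 'v::ab_group_add \<Rightarrow> 'v) \<Rightarrow> ('v \<Rightarrow> 'v \<Rightarrow> complex) \<Rightarrow> ('v \<Rightarrow> 'v) set" where
  "orthogonal_group scale b =
    {g. Vector_Spaces.linear scale scale g \<and> bij g \<and> (\<forall>x y. b (g x) (g y) = b x y)}"


section \<open>Tensors as multilinear forms\<close>

text \<open>
  An \<open>n\<close>-tuple of vectors is the restriction of a function \<open>v :: nat \<Rightarrow> 'v\<close> to \<open>{1..n}\<close>. Accordingly,
  a map on \<open>V^n\<close> is a map on such functions that depends only on the coordinates in \<open>{1..n}\<close>. For
  \<open>n = 0\<close> the multilinear forms are the constants.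
\<close>

definition multilinear_map ::
    "(complex \<Rightarrow> 'v::ab_group_add \<Rightarrow> 'v) \<Rightarrow> (complex \<Rightarrow> 'w::ab_group_add \<Rightarrow> 'w) \<Rightarrow> nat \<Rightarrow>
      ((nat \<Rightarrow> 'v) \<Rightarrow> 'w) \<Rightarrow> bool" where
  "multilinear_map s t n M \<longleftrightarrow>
    (\<forall>v w. (\<forall>i\<in>{1..n}. v i = w i) \<longrightarrow> M v = M w) \<and>
    (\<forall>i\<in>{1..n}. \<forall>v. Vector_Spaces.linear s t (\<lambda>x. M (v(i := x))))"

text \<open>
  Forms are added by the pointwise addition on function types; this is the matching scalar
  multiplication.
\<close>

definition scale_form :: "complex \<Rightarrow> ('a \<Rightarrow> complex) \<Rightarrow> 'a \<Rightarrow> complex" where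
  "scale_form c F = (\<lambda>v. c * F v)"

text \<open>
  The \<open>n\<close>-th tensor power of \<open>V\<close>, identified with the multilinear forms on \<open>V^n\<close>. Under the
  identification of \<open>V\<close> with its dual via \<open>b\<close>, the tensor \<open>v_1 \<otimes> \<dots> \<otimes> v_n\<close> is the form
  \<open>pure_tensor b n v\<close>. Lemma \<open>pure_tensor_in_tensor_power\<close> and theorem \<open>tensor_power_universal\<close>
  below show that these forms, together with \<open>pure_tensor b n\<close>, indeed satisfy the universal property
  of the tensor power, and \<open>tensor_action_pure_tensor\<close> that the action of the orthogonal group is
  the diagonal one.
\<close>

definition tensor_power ::
    "(complex \<Rightarrow> 'v::ab_group_add \<Rightarrow> 'v) \<Rightarrow> nat \<Rightarrow> ((nat \<Rightarrow> 'v) \<Rightarrow> complex) set" where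
  "tensor_power scale n = {F. multilinear_map scale (*) n F}"

definition pure_tensor ::
    "('v \<Rightarrow> 'v \<Rightarrow> complex) \<Rightarrow> nat \<Rightarrow> (nat \<Rightarrow> 'v) \<Rightarrow> (nat \<Rightarrow> 'v) \<Rightarrow> complex" where
  "pure_tensor b n v = (\<lambda>w. \<Prod>i=1..n. b (v i) (w i))"

definition tensor_action ::
    "('v \<Rightarrow> 'v) \<Rightarrow> ((nat \<Rightarrow> 'v) \<Rightarrow> complex) \<Rightarrow> (nat \<Rightarrow> 'v) \<Rightarrow> complex" where
  "tensor_action g F = (\<lambda>v. F (\<lambda>i. inv g (v i)))"

definition tensor_invariants ::
    "(complex \<Rightarrow> 'v::ab_group_add \<Rightarrow> 'v) \<Rightarrow> ('v \<Rightarrow> 'v \<Rightarrow> complex) \<Rightarrow> nat \<Rightarrow>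
      ((nat \<Rightarrow> 'v) \<Rightarrow> complex) set" where
  "tensor_invariants scale b n =
    {F \<in> tensor_power scale n. \<forall>g \<in> orthogonal_group scale b. tensor_action g F = F}"


section \<open>Arc diagrams\<close>

type_synonym arc = "nat \<times> nat"

text \<open>A diagram is the multiset of its arcs.\<close>

definition arc_diagram :: "nat \<Rightarrow> arc multiset \<Rightarrow> bool" where
  "arc_diagram n D \<longleftrightarrow> (\<forall>(i, j) \<in># D. 1 \<le> i \<and> i \<le> j \<and> j \<le> n)"

text \<open>A loop contributes 2 to the degree of its vertex.\<close>

definition vertex_degree :: "arc multiset \<Rightarrow> nat \<Rightarrow> nat" where
  "vertex_degree D x = count (image_mset fst D) x + count (image_mset snd D) x"

definition one_regular :: "nat \<Rightarrow> arc multiset \<Rightarrow> bool" where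
  "one_regular n D \<longleftrightarrow> arc_diagram n D \<and> (\<forall>x\<in>{1..n}. vertex_degree D x = 1)"

fun weakly_nested :: "arc \<Rightarrow> arc \<Rightarrow> bool" where
  "weakly_nested (i, j) (i', j') \<longleftrightarrow>
    (i \<le> i' \<and> i' \<le> j' \<and> j' \<le> j) \<or> (i' \<le> i \<and> i \<le> j \<and> j \<le> j')"

definition weak_nesting :: "arc set \<Rightarrow> bool" where
  "weak_nesting A \<longleftrightarrow> (\<forall>a\<in>A. \<forall>a'\<in>A. weakly_nested a a')"

definition decomposable_into_weak_nestings :: "nat \<Rightarrow> arc multiset \<Rightarrow> bool" where
  "decomposable_into_weak_nestings k D \<longleftrightarrow>
    (\<exists>P. partition_on (set_mset D) P \<and> card P \<le> k \<and> (\<forall>A\<in>P. weak_nesting A))"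

definition nesting_diagrams :: "nat \<Rightarrow> nat \<Rightarrow> arc multiset set" where
  "nesting_diagrams k n = {D. one_regular n D \<and> decomposable_into_weak_nestings k D}"

definition contraction ::
    "('v \<Rightarrow> 'v \<Rightarrow> complex) \<Rightarrow> nat \<Rightarrow> nat \<Rightarrow> (nat \<Rightarrow> 'v) \<Rightarrow> complex" where
  "contraction b i j = (\<lambda>v. b (v i) (v j))"

definition diagram_form ::
    "('v \<Rightarrow> 'v \<Rightarrow> complex) \<Rightarrow> arc multiset \<Rightarrow> (nat \<Rightarrow> 'v) \<Rightarrow> complex" where
  "diagram_form b D = (\<lambda>v. \<Prod>(i, j) \<in># D. contraction b i j v)"


section \<open>The identification with multilinear forms\<close>

lemma vector_space_scale_form: "vector_space scale_form"
  by unfold_locales (auto simp: scale_form_def fun_eq_iff algebra_simps)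

lemma sum_fun_apply: "(\<Sum>x\<in>A. F x) v = (\<Sum>x\<in>A. F x v)"
  for F :: "'a \<Rightarrow> 'b \<Rightarrow> complex"
  by (induction A rule: infinite_finite_induct) auto

lemma multilinear_map_expand:
  fixes c :: "'v::ab_group_add \<Rightarrow> 'e \<Rightarrow> complex" and s t
  assumes M: "multilinear_map s t n M" and t: "vector_space t"
    and B: "finite B" and expand: "\<And>x. x = (\<Sum>e\<in>B. s (c x e) (d e))"
    and S: "finite S" "S \<subseteq> {1..n}"
  shows "M v = (\<Sum>J\<in>S \<rightarrow>\<^sub>E B. t (\<Prod>i\<in>S. c (v i) (J i)) (M (\<lambda>i. if i \<in> S then d (J i) else v i)))"
  using S
proof (induction S rule: finite_induct)
  case empty
  interpret t: vector_space t by (fact t)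
  show ?case by simp
next
  case (insert j S)
  interpret t: vector_space t by (fact t)
  let ?u = "\<lambda>J i. if i \<in> S then d (J i) else v i"
  let ?u' = "\<lambda>J i. if i \<in> insert j S then d (J i) else v i"
  have step: "M (?u J) = (\<Sum>e\<in>B. t (c (v j) e) (M (?u' (J(j := e)))))" for J
  proof -
    interpret L: Vector_Spaces.linear s t "\<lambda>x. M ((?u J)(j := x))"
      using M insert.prems by (auto simp: multilinear_map_def)
    have "M (?u J) = M ((?u J)(j := v j))"
      using insert.hyps by (intro arg_cong[of _ _ M]) auto
    also have "\<dots> = M ((?u J)(j := (\<Sum>e\<in>B. s (c (v j) e) (d e))))"
      using expand[of "v j"] by simp
    also have "\<dots> = (\<Sum>e\<in>B. t (c (v j) e) (M ((?u J)(j := d e))))"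
      by (simp add: L.sum L.scale)
    also have "\<dots> = (\<Sum>e\<in>B. t (c (v j) e) (M (?u' (J(j := e)))))"
      using insert.hyps
      by (intro sum.cong refl arg_cong[of _ _ "t _"] arg_cong[of _ _ M]) (auto simp: fun_eq_iff)
    finally show ?thesis .
  qed
  have inj: "inj_on (\<lambda>(y, g). g(j := y)) (B \<times> (S \<rightarrow>\<^sub>E B))"
    using insert.hyps by (intro inj_combinator) auto
  have "M v = (\<Sum>J\<in>S \<rightarrow>\<^sub>E B. t (\<Prod>i\<in>S. c (v i) (J i)) (M (?u J)))"
    using insert by auto
  also have "\<dots> = (\<Sum>J\<in>S \<rightarrow>\<^sub>E B. \<Sum>e\<in>B.
      t (c (v j) e * (\<Prod>i\<in>S. c (v i) (J i))) (M (?u' (J(j := e)))))"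
    unfolding step by (simp add: t.scale_sum_right mult.commute)
  also have "\<dots> = (\<Sum>(e, J)\<in>B \<times> (S \<rightarrow>\<^sub>E B).
      t (c (v j) e * (\<Prod>i\<in>S. c (v i) (J i))) (M (?u' (J(j := e)))))"
    by (subst sum.swap) (simp add: sum.cartesian_product)
  also have "\<dots> = (\<Sum>J\<in>insert j S \<rightarrow>\<^sub>E B. t (\<Prod>i\<in>insert j S. c (v i) (J i)) (M (?u' J)))"
  proof -
    have "(\<Prod>i\<in>insert j S. c (v i) ((J(j := e)) i)) = c (v j) e * (\<Prod>i\<in>S. c (v i) (J i))" for J e
    proof -
      have "(\<Prod>i\<in>S. c (v i) ((J(j := e)) i)) = (\<Prod>i\<in>S. c (v i) (J i))"
        using insert.hyps by (intro prod.cong) auto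
      then show ?thesis using insert.hyps by simp
    qed
    then show ?thesis
      unfolding PiE_insert_eq by (subst sum.reindex[OF inj]) (auto intro!: sum.cong)
  qed
  finally show ?case .
qed

context symmetric_bilinear_space
begin

lemma dual_basis:
  "\<exists>B d. finite B \<and> (\<forall>x. x = (\<Sum>e\<in>B. b x e *s d e)) \<and> (\<forall>x. x = (\<Sum>e\<in>B. b x (d e) *s e))"
proof -
  obtain A where A: "finite A" "span A = UNIV" using finite_dim by blast
  obtain B where B: "B \<subseteq> A" "independent B" "A \<subseteq> span B"
    by (rule maximal_independent_subset)
  have finB: "finite B" using A(1) B(1) by (rule rev_finite_subset)
  have spanB: "span B = UNIV"
    using A(2) B(3) span_mono[OF B(3)] by (simp add: span_span top.extremum_unique)
  interpret finite_dimensional_vector_space scale B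
    using finB B(2) spanB by unfold_locales
  have lin1: "Vector_Spaces.linear (*s) (*) (\<lambda>x. b x y)" for y
  proof -
    have "(\<lambda>x. b x y) = b y" by (rule ext) (rule symmetric)
    then show ?thesis using linear_right[of y] by (simp only:)
  qed
  have add1: "b (x + x') y = b x y + b x' y" for x x' y
    using lin1[of y] by (simp add: Vector_Spaces.linear_iff)
  have scale1: "b (c *s x) y = c * b x y" for c x y
    using lin1[of y] by (simp add: Vector_Spaces.linear_iff)
  define T where "T x = (\<Sum>e\<in>B. b x e *s e)" for x
  have linT: "Vector_Spaces.linear (*s) (*s) T"
    unfolding Vector_Spaces.linear_iff T_def
    by (auto simp: vector_space_axioms add1 scale1 scale_left_distrib sum.distrib scale_sum_right)
  interpret T: Vector_Spaces.linear scale scale T by (fact linT)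
  have coeffs: "f = g" if "(\<Sum>e\<in>B. f e *s e) = (\<Sum>e\<in>B. g e *s e)" "\<forall>e. e \<notin> B \<longrightarrow> f e = g e" for f g
  proof
    fix e
    have "(\<Sum>e\<in>B. (f e - g e) *s e) = 0"
      using that by (simp add: scale_left_diff_distrib sum_subtractf)
    then have "\<forall>e\<in>B. f e - g e = 0"
      using B(2) finB independentD[OF B(2) finB subset_refl, of "\<lambda>e. f e - g e"] by blast
    then show "f e = g e" using that by (cases "e \<in> B") auto
  qed
  have zero: "x = 0" if "\<forall>e\<in>B. b x e = 0" for x
  proof (rule nondegenerate)
    fix y
    interpret bx: Vector_Spaces.linear scale "(*)" "b x" by (rule linear_right)
    have "y \<in> span B" using spanB by simp
    then show "b x y = 0"
      using bx.eq_0_on_span[of B] that by blast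
  qed
  have "inj T"
  proof (rule injI)
    fix x y assume "T x = T y"
    then have "T (x - y) = 0" by (simp add: T.diff)
    then have "\<forall>e\<in>B. b (x - y) e = 0"
      using independentD[OF B(2) finB subset_refl] unfolding T_def by blast
    then have "x - y = 0" by (rule zero)
    then show "x = y" by simp
  qed
  then have "surj T" using linT linear_inj_imp_surj by blast
  define d where "d = inv T"
  have Td: "T (d x) = x" for x using \<open>surj T\<close> by (simp add: d_def surj_f_inv_f)
  have delta: "b (d e) e' = (if e' = e then 1 else 0)" if "e \<in> B" "e' \<in> B" for e e'
  proof -
    have "(\<Sum>e'\<in>B. (if e' \<in> B then b (d e) e' else 0) *s e')
        = (\<Sum>e'\<in>B. (if e' = e then 1 else 0) *s e')"
    proof -
      have "(\<Sum>e'\<in>B. (if e' \<in> B then b (d e) e' else 0) *s e') = T (d e)"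
        unfolding T_def by (intro sum.cong) auto
      also have "\<dots> = (\<Sum>e'\<in>B. if e' = e then e' else 0)"
        using Td that finB by (simp add: sum.delta)
      also have "\<dots> = (\<Sum>e'\<in>B. (if e' = e then 1 else 0) *s e')"
        by (intro sum.cong) auto
      finally show ?thesis .
    qed
    from coeffs[OF this] have "(\<lambda>e'. if e' \<in> B then b (d e) e' else 0) = (\<lambda>e'. if e' = e then 1 else 0)"
      using that by auto
    from fun_cong[OF this, of e'] show ?thesis using that by simp
  qed
  have first: "x = (\<Sum>e\<in>B. b x e *s d e)" for x
  proof -
    have "T (\<Sum>e\<in>B. b x e *s d e) = T x"
      by (simp add: T.sum T.scale Td) (simp add: T_def)
    then show ?thesis using \<open>inj T\<close> by (metis injD)
  qed
  have second: "x = (\<Sum>e\<in>B. b x (d e) *s e)" for x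
  proof -
    have "x \<in> range (\<lambda>f. \<Sum>e\<in>B. f e *s e)"
      using spanB span_finite[OF finB] by simp
    then obtain f where f: "x = (\<Sum>e\<in>B. f e *s e)" by (rule rangeE)
    have "b x (d e) = f e" if "e \<in> B" for e
    proof -
      interpret l: Vector_Spaces.linear scale "(*)" "\<lambda>x. b x (d e)" by (rule lin1)
      have "b x (d e) = (\<Sum>e'\<in>B. f e' * b e' (d e))"
        unfolding f by (simp only: l.sum l.scale)
      also have "\<dots> = (\<Sum>e'\<in>B. if e' = e then f e' else 0)"
      proof (rule sum.cong[OF refl])
        fix e' assume "e' \<in> B"
        then show "f e' * b e' (d e) = (if e' = e then f e' else 0)"
          using delta[OF that] symmetric[of e' "d e"] by simp
      qed
      finally show ?thesis using that finB by simp
    qed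
    then have "(\<Sum>e\<in>B. b x (d e) *s e) = (\<Sum>e\<in>B. f e *s e)" by (intro sum.cong) auto
    then show ?thesis by (simp only: f[symmetric])
  qed
  show ?thesis by (intro exI[of _ B] exI[of _ d] conjI allI finB first second)
qed

lemma pure_tensor_in_tensor_power: "pure_tensor b n v \<in> tensor_power scale n"
proof -
  interpret F: vector_space "(*) :: complex \<Rightarrow> complex \<Rightarrow> complex"
    by unfold_locales (auto simp: algebra_simps)
  have "Vector_Spaces.linear (*s) (*) (\<lambda>x. pure_tensor b n v (w(j := x)))" if j: "j \<in> {1..n}" for j w
  proof -
    interpret l: Vector_Spaces.linear scale "(*)" "b (v j)" by (rule linear_right)
    have "pure_tensor b n v (w(j := x)) = b (v j) x * (\<Prod>i\<in>{1..n} - {j}. b (v i) (w i))" for x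
    proof -
      have "(\<Prod>i\<in>{1..n} - {j}. b (v i) ((w(j := x)) i)) = (\<Prod>i\<in>{1..n} - {j}. b (v i) (w i))"
        by (intro prod.cong) auto
      then show ?thesis
        using j unfolding pure_tensor_def by (subst prod.remove[of _ j]) auto
    qed
    then show ?thesis
      unfolding Vector_Spaces.linear_iff
      by (simp add: vector_space_axioms F.vector_space_axioms l.add l.scale ring_distribs)
  qed
  then show ?thesis
    by (auto simp: tensor_power_def multilinear_map_def pure_tensor_def intro!: prod.cong)
qed

lemma tensor_action_pure_tensor:
  assumes "g \<in> orthogonal_group scale b"
  shows "tensor_action g (pure_tensor b n v) = pure_tensor b n (\<lambda>i. g (v i))"
proof -
  have g: "bij g" "\<And>x y. b (g x) (g y) = b x y"
    using assms by (auto simp: orthogonal_group_def)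
  have "b x (inv g y) = b (g x) y" for x y
    using g(2)[of x "inv g y"] g(1) by (simp add: bij_is_surj surj_f_inv_f)
  then show ?thesis by (simp add: tensor_action_def pure_tensor_def)
qed

theorem tensor_power_universal:
  fixes t :: "complex \<Rightarrow> 'w::ab_group_add \<Rightarrow> 'w"
  assumes t: "vector_space t" and M: "multilinear_map scale t n M"
  shows "\<exists>L. Vector_Spaces.linear scale_form t L \<and> (\<forall>v. L (pure_tensor b n v) = M v) \<and>
    (\<forall>L'. Vector_Spaces.linear scale_form t L' \<and> (\<forall>v. L' (pure_tensor b n v) = M v) \<longrightarrow>
      (\<forall>F\<in>tensor_power scale n. L' F = L F))"
proof -
  interpret t: vector_space t by (fact t)
  interpret F: vector_space scale_form by (rule vector_space_scale_form)
  interpret C: vector_space "(*) :: complex \<Rightarrow> complex \<Rightarrow> complex"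
    by unfold_locales (auto simp: algebra_simps)
  obtain B d where Bd: "finite B \<and> (\<forall>x. x = (\<Sum>e\<in>B. b x e *s d e)) \<and> (\<forall>x. x = (\<Sum>e\<in>B. b x (d e) *s e))"
    using dual_basis by (elim exE)
  then have B: "finite B" by (rule conjunct1)
  have d1: "x = (\<Sum>e\<in>B. b x e *s d e)" for x
    using Bd[THEN conjunct2, THEN conjunct1] by (rule spec)
  have d2: "x = (\<Sum>e\<in>B. b x (d e) *s e)" for x
    using Bd[THEN conjunct2, THEN conjunct2] by (rule spec)
  let ?S = "{1..n}"
  define L where "L F = (\<Sum>J\<in>?S \<rightarrow>\<^sub>E B. t (F J) (M (\<lambda>i. d (J i))))" for F
  have cong: "K v = K w" if "multilinear_map scale r n K" "\<And>i. i \<in> ?S \<Longrightarrow> v i = w i"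
    for r :: "complex \<Rightarrow> 'x::ab_group_add \<Rightarrow> 'x" and K v w
    using that unfolding multilinear_map_def by blast
  have "Vector_Spaces.linear scale_form t L"
    unfolding Vector_Spaces.linear_iff L_def
    by (auto simp: t F.vector_space_axioms t.scale_left_distrib sum.distrib scale_form_def t.scale_sum_right)
  moreover have "L (pure_tensor b n v) = M v" for v
  proof -
    have "M v = (\<Sum>J\<in>?S \<rightarrow>\<^sub>E B. t (\<Prod>i\<in>?S. b (v i) (J i)) (M (\<lambda>i. if i \<in> ?S then d (J i) else v i)))"
      by (rule multilinear_map_expand[OF M t B d1]) auto
    also have "\<dots> = L (pure_tensor b n v)"
      unfolding L_def pure_tensor_def
      by (intro sum.cong refl arg_cong[of _ _ "t _"] cong[OF M]) auto
    finally show ?thesis by simp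
  qed
  moreover have "L' F = L F"
    if L': "Vector_Spaces.linear scale_form t L'" "\<forall>v. L' (pure_tensor b n v) = M v"
      and F: "F \<in> tensor_power scale n" for L' F
  proof -
    interpret L': Vector_Spaces.linear scale_form t L' by (fact L'(1))
    have mF: "multilinear_map scale (*) n F" using F by (simp add: tensor_power_def)
    have "F = (\<Sum>J\<in>?S \<rightarrow>\<^sub>E B. scale_form (F J) (pure_tensor b n (\<lambda>i. d (J i))))"
    proof
      fix w
      have "F w = (\<Sum>J\<in>?S \<rightarrow>\<^sub>E B. (\<Prod>i\<in>?S. b (w i) (d (J i))) * F (\<lambda>i. if i \<in> ?S then J i else w i))"
        by (rule multilinear_map_expand[OF mF C.vector_space_axioms B d2]) auto
      also have "\<dots> = (\<Sum>J\<in>?S \<rightarrow>\<^sub>E B. F J * pure_tensor b n (\<lambda>i. d (J i)) w)"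
      proof (intro sum.cong refl)
        fix J assume "J \<in> ?S \<rightarrow>\<^sub>E B"
        have "F (\<lambda>i. if i \<in> ?S then J i else w i) = F J" by (rule cong[OF mF]) auto
        then show "(\<Prod>i\<in>?S. b (w i) (d (J i))) * F (\<lambda>i. if i \<in> ?S then J i else w i)
            = F J * pure_tensor b n (\<lambda>i. d (J i)) w"
          by (simp add: pure_tensor_def symmetric[of "w _"])
      qed
      finally show "F w = (\<Sum>J\<in>?S \<rightarrow>\<^sub>E B. scale_form (F J) (pure_tensor b n (\<lambda>i. d (J i)))) w"
        by (simp add: sum_fun_apply scale_form_def)
    qed
    then have "L' F = L' (\<Sum>J\<in>?S \<rightarrow>\<^sub>E B. scale_form (F J) (pure_tensor b n (\<lambda>i. d (J i))))"
      by (rule arg_cong)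
    also have "\<dots> = L F"
      using L'(2) by (simp add: L'.sum L'.scale L_def)
    finally show ?thesis .
  qed
  ultimately show ?thesis by blast
qed

end

end

theory Submission
  imports Defs "HOL-Combinatorics.Permutations" "HOL-Library.Fun_Lexorder"
begin

text \<open>
  A 1-regular diagram on \<open>n\<close> vertices is a perfect matching \<open>D\<close> of the slots \<open>{1..n}\<close>, and its form is
  the product of \<open>b (v i) (v j)\<close> over the arcs. The theorem says that these forms span the
  invariants, that the matchings decomposable into \<open>k\<close> weak nestings already suffice, and that the
  latter are independent. Throughout, \<open>e 0, \<dots>, e (k - 1)\<close> is an orthonormal basis of \<open>V\<close>.

  \<^emph>\<open>All matchings span\<close> (\<open>first_fundamental_theorem\<close>), by induction on the number of slots. Let \<open>\<Delta>\<close>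
  be the span of the forms of matchings. Differentiating the invariance of a form \<open>F\<close> under
  rotations of the planes \<open>e a, e c\<close> and contracting the resulting identity with a slot \<open>q\<close> gives
  (\<open>star_sum_identity\<close>) that \<open>\<Sum>\<^sub>p (p q) F - (1 - k) F\<close>, where \<open>p\<close> runs over the other slots, equals
  \<open>\<Sum>\<^sub>p b (v p) (v q) * tr\<^sub>p\<^sub>q F\<close>. The traces are invariants in two slots fewer, so the right-hand side
  lies in \<open>\<Delta>\<close>. Hence on the symmetric group module of invariants modulo \<open>\<Delta>\<close> every star sum of
  transpositions (a Jucys-Murphy element) is the scalar \<open>1 - k\<close>. On the irreducible module of a Young
  diagram, the eigenvalues of such an element are the contents, column index minus row index, of the
  removable boxes; so only rectangles with \<open>k - 1\<close> more rows than columns can occur. As an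
  antisymmetrization over \<open>k + 1\<close> vectors of a \<open>k\<close>-dimensional space vanishes, there are at most \<open>k\<close>
  rows, and a single column of length \<open>k\<close> remains: the determinant, which a reflection changes in
  sign. Nothing is left, so all invariants lie in \<open>\<Delta>\<close>. Lemma \<open>star_sums_force_membership\<close> carries out
  this argument without representation theory, by splitting off one column of the diagram at a time.

  \<^emph>\<open>Few matchings suffice\<close> (\<open>straightening\<close>). If \<open>D\<close> is not decomposable into \<open>k\<close> weak nestings, it has
  \<open>k + 1\<close> arcs that are pairwise not nested. Antisymmetrizing the form of \<open>D\<close> over their right ends gives
  \<open>0\<close> and expresses it by matchings in which these right ends are permuted. Matchings are compared
  lexicographically through their partner functions; every nontrivial permutation of the right ends
  makes the matching larger, because the unpermuted arcs reach to the right as little as possible.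

  \<^emph>\<open>They are independent\<close> (\<open>nesting_diagrams_linearly_independent\<close>). Colour the vertices by the
  \<open>k\<close> nestings of \<open>D\<close> and put the basis vector \<open>e c\<close> into every slot of colour \<open>c\<close>. A matching takes the value
  \<open>1\<close> there if its arcs are monochromatic, and \<open>0\<close> otherwise; among the former, \<open>D\<close> is the lexicographically
  largest (\<open>nested_matching_is_largest\<close>). So the matrix of values is unitriangular.
\<close>


section \<open>Subspaces of forms and antisymmetrization\<close>

interpretation forms: vector_space "scale_form :: complex \<Rightarrow> ('a \<Rightarrow> complex) \<Rightarrow> 'a \<Rightarrow> complex"
  by (rule vector_space_scale_form)

lemma subspace_plus:
  assumes "forms.subspace S" "F \<in> S" "G \<in> S"
  shows "(\<lambda>v. F v + G v) \<in> S"
proof -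
  have "(\<lambda>v. F v + G v) = F + G" by (auto simp: fun_eq_iff)
  then show ?thesis using forms.subspace_add[OF assms] by simp
qed

lemma subspace_times:
  assumes "forms.subspace S" "F \<in> S"
  shows "(\<lambda>v. c * F v) \<in> S"
  using forms.subspace_scale[OF assms, of c] by (simp add: scale_form_def)

lemma subspace_zero: "forms.subspace S \<Longrightarrow> (\<lambda>v. 0) \<in> S"
  using forms.subspace_0[of S] by (simp add: zero_fun_def)

lemma subspace_sum_fun:
  assumes "forms.subspace S" "\<And>i. i \<in> I \<Longrightarrow> F i \<in> S"
  shows "(\<lambda>v. \<Sum>i\<in>I. F i v) \<in> S"
  using assms(2)
  by (induction I rule: infinite_finite_induct) (auto simp: subspace_zero subspace_plus assms(1))

lemma subspaceI_fun:
  assumes "(\<lambda>v. 0) \<in> S" "\<And>F G. F \<in> S \<Longrightarrow> G \<in> S \<Longrightarrow> (\<lambda>v. F v + G v) \<in> S"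
    and "\<And>c F. F \<in> S \<Longrightarrow> (\<lambda>v. c * F v) \<in> S"
  shows "forms.subspace S"
  using assms unfolding forms.subspace_def by (auto simp: scale_form_def zero_fun_def plus_fun_def)

definition antisymmetrize :: "nat set \<Rightarrow> ((nat \<Rightarrow> 'v) \<Rightarrow> complex) \<Rightarrow> (nat \<Rightarrow> 'v) \<Rightarrow> complex" where
  "antisymmetrize K F = (\<lambda>v. \<Sum>\<sigma> | \<sigma> permutes K. of_int (sign \<sigma>) * F (v \<circ> \<sigma>))"

lemma antisymmetrize_singleton: "antisymmetrize {x} F = F"
  by (simp add: antisymmetrize_def)

text \<open>
  The permutations of \<open>insert q K\<close> are products of a transposition \<open>(q p)\<close> with a permutation of
  \<open>K\<close>. Read from right to left, the identity says how the transpositions between \<open>q\<close> and \<open>K\<close> act on forms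
  that are antisymmetric on \<open>K\<close>.
\<close>

lemma antisymmetrize_insert:
  assumes "finite K" "q \<notin> K"
  shows "antisymmetrize (insert q K) F v = antisymmetrize K F v - (\<Sum>p\<in>K. antisymmetrize K F (v \<circ> transpose p q))"
proof -
  have "antisymmetrize (insert q K) F v =
      (\<Sum>p\<in>insert q K. \<Sum>\<sigma> | \<sigma> permutes K. of_int (sign (transpose q p \<circ> \<sigma>)) * F (v \<circ> (transpose q p \<circ> \<sigma>)))"
    unfolding antisymmetrize_def by (rule sum_over_permutations_insert[OF assms])
  also have "\<dots> = (\<Sum>p\<in>insert q K. (if p = q then 1 else -1) * antisymmetrize K F (v \<circ> transpose p q))"
    unfolding antisymmetrize_def sum_distrib_left
    using assms(1) by (intro sum.cong refl)
      (auto simp: sign_compose permutes_imp_permutation permutation_swap_id sign_swap_id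
        transpose_commute[of q] o_assoc)
  also have "\<dots> = antisymmetrize K F v - (\<Sum>p\<in>K. antisymmetrize K F (v \<circ> transpose p q))"
  proof -
    have "(\<Sum>p\<in>K. (if p = q then 1 else -1) * antisymmetrize K F (v \<circ> transpose p q))
        = (\<Sum>p\<in>K. - antisymmetrize K F (v \<circ> transpose p q))"
      using assms(2) by (intro sum.cong) auto
    then show ?thesis using assms by (simp add: sum_negf)
  qed
  finally show ?thesis .
qed

lemma antisymmetrize_transpose:
  assumes "finite K" "p \<in> K" "q \<in> K" "p \<noteq> q"
  shows "antisymmetrize K F (v \<circ> transpose p q) = - antisymmetrize K F v"
proof -
  have "antisymmetrize K F v =
      (\<Sum>\<sigma> | \<sigma> permutes K. of_int (sign (transpose p q \<circ> \<sigma>)) * F (v \<circ> (transpose p q \<circ> \<sigma>)))"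
    unfolding antisymmetrize_def using assms by (intro setum_permutations_compose_left permutes_swap_id)
  also have "\<dots> = (\<Sum>\<sigma> | \<sigma> permutes K. - (of_int (sign \<sigma>) * F ((v \<circ> transpose p q) \<circ> \<sigma>)))"
    using assms(1,4) by (intro sum.cong refl)
      (auto simp: sign_compose permutes_imp_permutation permutation_swap_id sign_swap_id o_assoc)
  finally show ?thesis by (simp add: antisymmetrize_def sum_negf)
qed

lemma antisymmetrize_commute:
  assumes "K \<inter> L = {}"
  shows "antisymmetrize K (antisymmetrize L F) = antisymmetrize L (antisymmetrize K F)"
proof
  fix v
  have comm: "\<sigma> \<circ> \<tau> = \<tau> \<circ> \<sigma>" if "\<sigma> permutes K" "\<tau> permutes L" for \<sigma> \<tau>
  proof
    fix x
    consider "x \<in> K" | "x \<in> L" | "x \<notin> K" "x \<notin> L" by blast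
    then show "(\<sigma> \<circ> \<tau>) x = (\<tau> \<circ> \<sigma>) x"
    proof cases
      case 1
      then have "\<sigma> x \<in> K" using permutes_in_image[OF that(1)] by simp
      then show ?thesis using 1 that assms permutes_not_in[OF that(2)] by (metis comp_apply disjoint_iff)
    next
      case 2
      then have "\<tau> x \<in> L" using permutes_in_image[OF that(2)] by simp
      then show ?thesis using 2 that assms permutes_not_in[OF that(1)] by (metis comp_apply disjoint_iff)
    next
      case 3
      then show ?thesis using that by (simp add: permutes_not_in)
    qed
  qed
  have "antisymmetrize K (antisymmetrize L F) v = (\<Sum>\<sigma> | \<sigma> permutes K. \<Sum>\<tau> | \<tau> permutes L.
      of_int (sign \<sigma>) * (of_int (sign \<tau>) * F (v \<circ> (\<sigma> \<circ> \<tau>))))"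
    by (simp add: antisymmetrize_def sum_distrib_left o_assoc)
  also have "\<dots> = (\<Sum>\<tau> | \<tau> permutes L. \<Sum>\<sigma> | \<sigma> permutes K.
      of_int (sign \<tau>) * (of_int (sign \<sigma>) * F (v \<circ> (\<tau> \<circ> \<sigma>))))"
    by (subst sum.swap) (auto intro!: sum.cong simp: comm mult_ac)
  also have "\<dots> = antisymmetrize L (antisymmetrize K F) v"
    by (simp add: antisymmetrize_def sum_distrib_left o_assoc)
  finally show "antisymmetrize K (antisymmetrize L F) v = antisymmetrize L (antisymmetrize K F) v" .
qed

text \<open>
  Modulo \<open>\<Delta>\<close>, the star sums of transpositions at all slots act on \<open>M\<close> as the scalar \<open>s\<close>, and
  antisymmetrizations over \<open>k + 1\<close> slots vanish. To see that \<open>M\<close> vanishes, lower the size of the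
  vanishing antisymmetrizations one by one, down to \<open>1\<close>, where the antisymmetrization is the identity.
  Suppose that they vanish for the size following that of \<open>K\<close>.

  If \<open>K \<noteq> P\<close>, the antisymmetrization over \<open>insert q K\<close> vanishes, so by \<open>antisymmetrize_insert\<close> the
  transpositions between \<open>q\<close> and \<open>K\<close> contribute \<open>1\<close> to the star sum at \<open>q\<close> of a form that is
  antisymmetric on \<open>K\<close>. The star sums over the slots in \<open>P - K\<close> are therefore the scalar \<open>s - 1\<close>
  on these forms, and the lemma applies to them and to the smaller set \<open>P - K\<close>.

  If \<open>K = P\<close>, every transposition acts as \<open>-1\<close> and the star sum as \<open>1 - card P\<close>. This differs from \<open>s\<close>
  except in the case \<open>s = 1 - k\<close>, \<open>card P = k\<close>, which the last hypothesis covers. That case does not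
  come up again after the first step, since \<open>s - 1\<close> is too small.
\<close>

lemma star_sums_force_membership:
  fixes M \<Delta> :: "((nat \<Rightarrow> 'v) \<Rightarrow> complex) set"
  assumes "finite P" "P \<noteq> {}"
    and "forms.subspace \<Delta>"
    and "\<And>F K. F \<in> M \<Longrightarrow> K \<subseteq> P \<Longrightarrow> antisymmetrize K F \<in> M"
    and "\<And>F q. F \<in> M \<Longrightarrow> q \<in> P \<Longrightarrow>
      (\<lambda>v. (\<Sum>p\<in>P - {q}. F (v \<circ> transpose p q)) - of_int s * F v) \<in> \<Delta>"
    and "\<And>F K. F \<in> M \<Longrightarrow> K \<subseteq> P \<Longrightarrow> card K = Suc k \<Longrightarrow> antisymmetrize K F \<in> \<Delta>"
    and "s \<le> 1 - int k"
    and "\<And>F. F \<in> M \<Longrightarrow> s = 1 - int k \<Longrightarrow> card P = k \<Longrightarrow> antisymmetrize P F \<in> \<Delta>"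
  shows "M \<subseteq> \<Delta>"
  using assms
proof (induction "card P" arbitrary: P M s k rule: less_induct)
  case less
  note fin = less.prems(1) and ne = less.prems(2) and sub = less.prems(3) and closed = less.prems(4)
    and star = less.prems(5) and anti = less.prems(6) and s = less.prems(7) and full = less.prems(8)
  have "\<forall>K\<subseteq>P. card K = Suc m \<longrightarrow> (\<forall>F\<in>M. antisymmetrize K F \<in> \<Delta>)" if "m \<le> k" for m
    using that
  proof (induction rule: inc_induct)
    case base
    then show ?case using anti by blast
  next
    case (step m)
    show ?case
    proof (intro allI impI ballI)
      fix K F assume K: "K \<subseteq> P" "card K = Suc m" and F: "F \<in> M"
      have finK: "finite K" using K(1) fin by (rule finite_subset)
      show "antisymmetrize K F \<in> \<Delta>"
      proof (cases "K = P")
        case True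
        show ?thesis
        proof (cases "s = 1 - int k \<and> card P = k")
          case True
          then show ?thesis using full F \<open>K = P\<close> by blast
        next
          case False
          obtain q where q: "q \<in> P" using ne by blast
          have "antisymmetrize P F \<in> M" using closed F by blast
          from star[OF this q] have "(\<lambda>v. (\<Sum>p\<in>P - {q}. antisymmetrize P F (v \<circ> transpose p q))
              - of_int s * antisymmetrize P F v) \<in> \<Delta>" .
          also have "(\<lambda>v. (\<Sum>p\<in>P - {q}. antisymmetrize P F (v \<circ> transpose p q))
              - of_int s * antisymmetrize P F v) = (\<lambda>v. of_int (- int m - s) * antisymmetrize P F v)"
          proof
            fix v
            have "(\<Sum>p\<in>P - {q}. antisymmetrize P F (v \<circ> transpose p q)) = (\<Sum>p\<in>P - {q}. - antisymmetrize P F v)"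
              using q fin by (intro sum.cong refl antisymmetrize_transpose) auto
            also have "\<dots> = - of_nat m * antisymmetrize P F v"
              using q fin K True by simp
            finally show "(\<Sum>p\<in>P - {q}. antisymmetrize P F (v \<circ> transpose p q)) - of_int s * antisymmetrize P F v
              = of_int (- int m - s) * antisymmetrize P F v" by (simp add: algebra_simps)
          qed
          finally have in\<Delta>: "(\<lambda>v. of_int (- int m - s) * antisymmetrize P F v) \<in> \<Delta>" .
          have nz: "- int m - s \<noteq> 0" using False step.hyps s K True by auto
          have "(\<lambda>v. (1 / of_int (- int m - s)) * (of_int (- int m - s) * antisymmetrize P F v)) \<in> \<Delta>"
            by (rule subspace_times[OF sub in\<Delta>])
          moreover have "(of_int (- int m - s) :: complex) \<noteq> 0" using nz by (simp only: of_int_eq_0_iff) simp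
          ultimately show ?thesis using True by simp
        qed
      next
        case False
        have "antisymmetrize K ` M \<subseteq> \<Delta>"
        proof (rule less.hyps[of "P - K" _ _ "Suc m"])
          show "card (P - K) < card P"
            proof (rule psubset_card_mono[OF fin])
            have "K \<noteq> {}" using K(2) by auto
            then show "P - K \<subset> P" using K(1) by blast
          qed
          show "P - K \<noteq> {}" using False K by blast
          show "s - 1 \<le> 1 - int (Suc m)" using s step.hyps by linarith
          show "antisymmetrize L G \<in> antisymmetrize K ` M" if "G \<in> antisymmetrize K ` M" "L \<subseteq> P - K" for G L
          proof -
            from that(1) obtain H where H: "H \<in> M" "G = antisymmetrize K H" by blast
            have "antisymmetrize L G = antisymmetrize K (antisymmetrize L H)"
              unfolding H(2) using that by (intro antisymmetrize_commute) auto
            moreover have "antisymmetrize L H \<in> M" using closed[OF H(1), of L] that(2) by blast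
            ultimately show ?thesis by (rule image_eqI)
          qed
          show "antisymmetrize L G \<in> \<Delta>" if "G \<in> antisymmetrize K ` M" "L \<subseteq> P - K" "card L = Suc (Suc m)" for G L
          proof -
            from that(1) obtain H where H: "H \<in> M" "G = antisymmetrize K H" by blast
            have "G \<in> M" using closed[OF H(1) K(1)] H(2) by simp
            moreover have "L \<subseteq> P" using that(2) by blast
            ultimately show ?thesis using step.IH that(3) by blast
          qed
          show "(\<lambda>v. (\<Sum>p\<in>P - K - {q}. G (v \<circ> transpose p q)) - of_int (s - 1) * G v) \<in> \<Delta>"
            if "G \<in> antisymmetrize K ` M" "q \<in> P - K" for G q
          proof -
            from that(1) obtain H where H: "H \<in> M" "G = antisymmetrize K H" by blast
            have "G \<in> M" using closed[OF H(1) K(1)] H(2) by simp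
            then have 1: "(\<lambda>v. (\<Sum>p\<in>P - {q}. G (v \<circ> transpose p q)) - of_int s * G v) \<in> \<Delta>"
              using star[of G q] that(2) by blast
            have 2: "antisymmetrize (insert q K) H \<in> \<Delta>"
            proof -
              have "insert q K \<subseteq> P" "card (insert q K) = Suc (Suc m)" using that(2) K finK by auto
              then show ?thesis using step.IH H(1) by blast
            qed
            have "(\<Sum>p\<in>P - K - {q}. G (v \<circ> transpose p q)) - of_int (s - 1) * G v =
              ((\<Sum>p\<in>P - {q}. G (v \<circ> transpose p q)) - of_int s * G v) + antisymmetrize (insert q K) H v" for v
            proof -
              have "(\<Sum>p\<in>P - {q}. G (v \<circ> transpose p q)) =
                (\<Sum>p\<in>P - K - {q}. G (v \<circ> transpose p q)) + (\<Sum>p\<in>K. G (v \<circ> transpose p q))"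
              proof -
                have "K \<subseteq> P - {q}" "P - {q} - K = P - K - {q}" using K(1) that(2) by auto
                then show ?thesis
                  using fin sum.subset_diff[of K "P - {q}" "\<lambda>p. G (v \<circ> transpose p q)"] by simp
              qed
              then show ?thesis
                using antisymmetrize_insert[OF finK, of q H v] that(2) H(2) by (simp add: algebra_simps)
            qed
            then show ?thesis using subspace_plus[OF sub 1 2] by simp
          qed
          show "antisymmetrize (P - K) G \<in> \<Delta>" if "s - 1 = 1 - int (Suc m)" for G
            using that s step.hyps by linarith
        qed (use fin sub in auto)
        then show ?thesis using F by blast
      qed
    qed
  qed
  from this[of 0] have T1: "\<forall>K\<subseteq>P. card K = 1 \<longrightarrow> (\<forall>F\<in>M. antisymmetrize K F \<in> \<Delta>)" by simp
  obtain x where "x \<in> P" using ne by blast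
  show "M \<subseteq> \<Delta>"
  proof
    fix F assume "F \<in> M"
    then have "antisymmetrize {x} F \<in> \<Delta>" using T1 \<open>x \<in> P\<close> by simp
    then show "F \<in> \<Delta>" by (simp add: antisymmetrize_singleton)
  qed
qed


section \<open>Perfect matchings and their nestings\<close>

text \<open>
  A 1-regular diagram on an arbitrary set of slots, as contracting two slots of a form leaves
  the interval \<open>{1..n}\<close>.
\<close>

definition matching :: "nat set \<Rightarrow> arc multiset \<Rightarrow> bool" where
  "matching P D \<longleftrightarrow> (\<forall>(i, j) \<in># D. i < j) \<and> (\<forall>x. vertex_degree D x = (if x \<in> P then 1 else 0))"

lemma vertex_degree_empty [simp]: "vertex_degree {#} x = 0"
  by (simp add: vertex_degree_def)

lemma vertex_degree_add_mset [simp]: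
  "vertex_degree (add_mset (i, j) D) x = of_bool (x = i) + of_bool (x = j) + vertex_degree D x"
  by (auto simp: vertex_degree_def)

lemma vertex_degree_arc:
  assumes "(i, j) \<in># D"
  shows "vertex_degree D i > 0" "vertex_degree D j > 0" "i = j \<Longrightarrow> vertex_degree D i \<ge> 2"
proof -
  obtain D' where D: "D = add_mset (i, j) D'" using assms by (metis insert_DiffM)
  show "vertex_degree D i > 0" "vertex_degree D j > 0" "i = j \<Longrightarrow> vertex_degree D i \<ge> 2"
    unfolding D by auto
qed

lemma vertex_degree_nonzeroE:
  assumes "vertex_degree D x \<noteq> 0"
  obtains y where "(x, y) \<in># D \<or> (y, x) \<in># D"
proof -
  have "x \<in># image_mset fst D \<or> x \<in># image_mset snd D"
    using assms unfolding vertex_degree_def by (metis add_cancel_right_left count_inI)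
  then show ?thesis using that by fastforce
qed

lemma one_regular_iff_matching: "one_regular n D \<longleftrightarrow> matching {1..n} D"
proof
  assume D: "one_regular n D"
  have arc: "1 \<le> i \<and> i \<le> j \<and> j \<le> n" if "(i, j) \<in># D" for i j
    using D that by (auto simp: one_regular_def arc_diagram_def)
  have "i < j" if "(i, j) \<in># D" for i j
  proof -
    have "i \<noteq> j"
    proof
      assume "i = j"
      then have "vertex_degree D i \<ge> 2" "i \<in> {1..n}" using vertex_degree_arc(3) arc that by auto
      then show False using D by (auto simp: one_regular_def)
    qed
    then show ?thesis using arc[OF that] by simp
  qed
  moreover have "vertex_degree D x = 0" if "x \<notin> {1..n}" for x
  proof (rule ccontr)
    assume "vertex_degree D x \<noteq> 0"
    then obtain y where "(x, y) \<in># D \<or> (y, x) \<in># D" by (rule vertex_degree_nonzeroE)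
    then show False using arc that by fastforce
  qed
  ultimately show "matching {1..n} D"
    using D by (auto simp: matching_def one_regular_def)
next
  assume D: "matching {1..n} D"
  have "i \<in> {1..n}" "j \<in> {1..n}" if "(i, j) \<in># D" for i j
    using vertex_degree_arc(1,2)[OF that] D unfolding matching_def
    by (metis less_numeral_extra(3))+
  then show "one_regular n D"
    using D by (fastforce simp: matching_def one_regular_def arc_diagram_def)
qed

lemma matching_empty_iff: "matching P {#} \<longleftrightarrow> P = {}"
  by (auto simp: matching_def)

lemma matching_add_mset_iff:
  "matching P (add_mset (i, j) D) \<longleftrightarrow> i < j \<and> i \<in> P \<and> j \<in> P \<and> matching (P - {i, j}) D"
proof -
  have "(\<forall>x. vertex_degree (add_mset (i, j) D) x = (if x \<in> P then 1 else 0)) \<longleftrightarrow>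
      i \<in> P \<and> j \<in> P \<and> (\<forall>x. vertex_degree D x = (if x \<in> P - {i, j} then 1 else 0))"
    if "i < j"
  proof (intro iffI conjI allI)
    assume *: "\<forall>x. vertex_degree (add_mset (i, j) D) x = (if x \<in> P then 1 else 0)"
    show "i \<in> P" using *[rule_format, of i] by (auto split: if_splits)
    show "j \<in> P" using *[rule_format, of j] by (auto split: if_splits)
    show "vertex_degree D x = (if x \<in> P - {i, j} then 1 else 0)" for x
      using *[rule_format, of x] that by (auto split: if_splits)
  qed (use that in \<open>auto split: if_splits\<close>)
  then show ?thesis by (auto simp: matching_def)
qed

lemma matching_arc:
  assumes "matching P D" "(i, j) \<in># D"
  shows "i < j" "i \<in> P" "j \<in> P"
  using assms matching_add_mset_iff[of P i j "D - {#(i, j)#}"] by auto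

lemma matching_arc_unique:
  assumes "matching P D" "a \<in># D" "a' \<in># D"
    and "x = fst a \<or> x = snd a" "x = fst a' \<or> x = snd a'"
  shows "a = a'"
proof (rule ccontr)
  assume "a \<noteq> a'"
  obtain i j i' j' where a: "a = (i, j)" "a' = (i', j')" by fastforce
  have "matching (P - {i, j}) (D - {#a#})"
    using assms(1,2) matching_add_mset_iff[of P i j "D - {#(i, j)#}"] by (simp add: a)
  moreover have "a' \<in># D - {#a#}" using assms(3) \<open>a \<noteq> a'\<close> by (simp add: in_diff_count)
  ultimately have "i' \<in> P - {i, j}" "j' \<in> P - {i, j}" using matching_arc a(2) by blast+
  then show False using assms(4,5) a by auto
qed

lemma matching_eq_mset_set:
  assumes "matching P D"
  shows "D = mset_set (set_mset D)"
proof (rule multiset_eqI)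
  fix a
  have "count D a = 1" if a: "a \<in># D"
  proof -
    obtain i j where ij: "a = (i, j)" by fastforce
    have "matching (P - {i, j}) (D - {#a#})"
      using assms a matching_add_mset_iff[of P i j "D - {#(i, j)#}"] by (simp add: ij)
    then have "a \<notin># D - {#a#}" using matching_arc ij by blast
    moreover have "count D a > 0" using a by simp
    ultimately show ?thesis using count_greater_zero_iff by (simp add: not_in_iff del: count_greater_zero_iff)
  qed
  then show "count D a = count (mset_set (set_mset D)) a"
    by (cases "a \<in># D") (auto simp: not_in_iff)
qed

lemma finite_matchings:
  assumes "finite P"
  shows "finite {D. matching P D}"
proof (rule finite_subset)
  show "{D. matching P D} \<subseteq> mset_set ` Pow (P \<times> P)"
  proof
    fix D assume "D \<in> {D. matching P D}"
    then have D: "matching P D" by simp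
    have "set_mset D \<subseteq> P \<times> P" using matching_arc[OF D] by auto
    then show "D \<in> mset_set ` Pow (P \<times> P)" using matching_eq_mset_set[OF D] by blast
  qed
qed (use assms in simp)

text \<open>
  Vertices outside of the matched set are their own partners. So two matchings of the same set have
  partner functions that differ only on this set.
\<close>

definition partner :: "arc multiset \<Rightarrow> nat \<Rightarrow> nat" where
  "partner D x = (if \<exists>y. (x, y) \<in># D \<or> (y, x) \<in># D
    then THE y. (x, y) \<in># D \<or> (y, x) \<in># D else x)"

lemma partner_eqI:
  assumes "matching P D" "(x, y) \<in># D \<or> (y, x) \<in># D"
  shows "partner D x = y"
proof -
  have "z = y" if "(x, z) \<in># D \<or> (z, x) \<in># D" for z
  proof -
    from that assms(2) obtain a a' where aa: "a \<in># D" "a' \<in># D" "a = (x, z) \<or> a = (z, x)"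
      "a' = (x, y) \<or> a' = (y, x)" by blast
    then have "a = a'" using matching_arc_unique[OF assms(1), of a a' x] by auto
    then show ?thesis using aa(3,4) matching_arc(1)[OF assms(1)] aa(1,2) by auto
  qed
  then have "(THE z. (x, z) \<in># D \<or> (z, x) \<in># D) = y"
    using assms(2) by (intro the_equality) blast+
  then show ?thesis using assms(2) unfolding partner_def by auto
qed

lemma partner_arc:
  assumes "matching P D" "x \<in> P"
  shows "(x, partner D x) \<in># D \<or> (partner D x, x) \<in># D"
proof -
  have "vertex_degree D x \<noteq> 0" using assms by (simp add: matching_def)
  then obtain y where "(x, y) \<in># D \<or> (y, x) \<in># D" by (rule vertex_degree_nonzeroE)
  then show ?thesis using partner_eqI[OF assms(1)] by metis
qed

lemma partner_outside:
  assumes "matching P D" "x \<notin> P"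
  shows "partner D x = x"
  using assms matching_arc[OF assms(1)] unfolding partner_def by auto

lemma partner_partner:
  assumes "matching P D"
  shows "partner D (partner D x) = x"
  using partner_arc[OF assms] partner_eqI[OF assms] partner_outside[OF assms] by metis

lemma matching_mem_iff:
  assumes "matching P D"
  shows "(i, j) \<in># D \<longleftrightarrow> i < j \<and> partner D i = j"
  using partner_arc[OF assms, of i] partner_eqI[OF assms] matching_arc[OF assms]
    partner_outside[OF assms, of i] by (metis less_asym less_irrefl)

lemma matching_eqI:
  assumes "matching P D" "matching P' D'" "partner D = partner D'"
  shows "D = D'"
proof -
  have "set_mset D = set_mset D'"
    using matching_mem_iff[OF assms(1)] matching_mem_iff[OF assms(2)] assms(3) by auto
  then show ?thesis using matching_eq_mset_set assms(1,2) by metis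
qed

text \<open>
  Sorting the ends of the moved arcs keeps the result a diagram. The forms are not affected, as \<open>b\<close> is
  symmetric.
\<close>

definition relabel :: "(nat \<Rightarrow> nat) \<Rightarrow> arc multiset \<Rightarrow> arc multiset" where
  "relabel \<tau> D = image_mset (\<lambda>(i, j). (min (\<tau> i) (\<tau> j), max (\<tau> i) (\<tau> j))) D"

lemma matching_relabel:
  assumes "matching P D" "\<tau> permutes P"
  shows "matching P (relabel \<tau> D)"
proof -
  have "vertex_degree (relabel \<tau> D) (\<tau> x) = vertex_degree D x" for x
  proof (induction D)
    case (add a D)
    obtain i j where a: "a = (i, j)" by fastforce
    have "of_bool (\<tau> x = min (\<tau> i) (\<tau> j)) + of_bool (\<tau> x = max (\<tau> i) (\<tau> j))
      = (of_bool (x = i) + of_bool (x = j) :: nat)"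
      using inj_eq[OF permutes_inj[OF assms(2)]] by (auto simp: min_def max_def)
    then show ?case using add by (simp add: a relabel_def)
  qed (simp add: relabel_def)
  then have "vertex_degree (relabel \<tau> D) (\<tau> x) = (if \<tau> x \<in> P then 1 else 0)" for x
    using assms by (simp add: matching_def permutes_in_image)
  then have "vertex_degree (relabel \<tau> D) x = (if x \<in> P then 1 else 0)" for x
    using permutes_surj[OF assms(2)] by (metis surjD)
  moreover have "i < j" if "(i, j) \<in># relabel \<tau> D" for i j
  proof -
    from that obtain i' j' where ij: "(i', j') \<in># D" "i = min (\<tau> i') (\<tau> j')" "j = max (\<tau> i') (\<tau> j')"
      by (auto simp: relabel_def)
    have "\<tau> i' \<noteq> \<tau> j'"
      using matching_arc(1)[OF assms(1) ij(1)] inj_eq[OF permutes_inj[OF assms(2)]] by auto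
    then show ?thesis using ij(2,3) by simp
  qed
  ultimately show ?thesis
    by (auto simp: matching_def)
qed

lemma partner_relabel:
  assumes "matching P D" "\<tau> permutes P"
  shows "partner (relabel \<tau> D) (\<tau> x) = \<tau> (partner D x)"
proof (cases "x \<in> P")
  case True
  have mem: "(min (\<tau> i) (\<tau> j), max (\<tau> i) (\<tau> j)) \<in># relabel \<tau> D" if "(i, j) \<in># D" for i j
    using that unfolding relabel_def by force
  have "(\<tau> x, \<tau> (partner D x)) \<in># relabel \<tau> D \<or> (\<tau> (partner D x), \<tau> x) \<in># relabel \<tau> D"
    using partner_arc[OF assms(1) True]
    by (elim disjE; drule_tac mem) (auto simp: min_def max_def split: if_splits)
  then show ?thesis by (rule partner_eqI[OF matching_relabel[OF assms]])
next
  case False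
  then show ?thesis using permutes_not_in[OF assms(2) False]
      partner_outside[OF assms(1) False] partner_outside[OF matching_relabel[OF assms] False] by simp
qed

text \<open>
  A strict partial order on arcs. Two arcs of a matching are comparable if and only if they are not
  weakly nested.
\<close>

definition unnested_before :: "arc \<Rightarrow> arc \<Rightarrow> bool" where
  "unnested_before a a' \<longleftrightarrow> fst a < fst a' \<and> snd a < snd a'"

definition pairwise_unnested :: "arc set \<Rightarrow> bool" where
  "pairwise_unnested C \<longleftrightarrow> (\<forall>a\<in>C. \<forall>a'\<in>C. a \<noteq> a' \<longrightarrow> unnested_before a a' \<or> unnested_before a' a)"

lemma weakly_nested_iff:
  assumes "matching P D" "a \<in># D" "a' \<in># D"
  shows "weakly_nested a a' \<longleftrightarrow> \<not> unnested_before a a' \<and> \<not> unnested_before a' a"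
proof -
  obtain i j i' j' where a: "a = (i, j)" "a' = (i', j')" by fastforce
  have "i < j" "i' < j'" using assms matching_arc(1) a by blast+
  moreover have "i = i' \<Longrightarrow> j = j'"
    using matching_arc_unique[OF assms(1,2,3), of i] a by simp
  moreover have "j = j' \<Longrightarrow> i = i'"
    using matching_arc_unique[OF assms(1,2,3), of j] a by simp
  ultimately show ?thesis unfolding a by (auto simp: unnested_before_def)
qed

text \<open>
  Mirsky's theorem for the partial order \<open>unnested_before\<close>: the arcs of equal height, where the
  height of an arc is the largest size of a chain ending in it, are pairwise incomparable, hence
  nested.
\<close>

lemma decomposable_if_unnested_sets_small:
  assumes D: "matching P D"
    and small: "\<And>C. C \<subseteq> set_mset D \<Longrightarrow> pairwise_unnested C \<Longrightarrow> card C \<le> k"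
  shows "decomposable_into_weak_nestings k D"
proof -
  let ?A = "set_mset D"
  define chains where "chains a = {C. C \<subseteq> ?A \<and> pairwise_unnested C \<and> a \<in> C \<and>
    (\<forall>c\<in>C. c = a \<or> unnested_before c a)}" for a
  define h where "h a = Max (card ` chains a)" for a
  have fin: "finite (chains a)" for a
    by (rule finite_subset[of _ "Pow ?A"]) (auto simp: chains_def)
  have ne: "{a} \<in> chains a" if "a \<in># D" for a
    using that by (auto simp: chains_def pairwise_unnested_def)
  have h_attained: "\<exists>C\<in>chains a. card C = h a" if "a \<in># D" for a
  proof -
    have "h a \<in> card ` chains a"
      unfolding h_def using fin ne[OF that] by (intro Max_in) auto
    then show ?thesis by auto
  qed
  have h_range: "h a \<in> {1..k}" if "a \<in># D" for a
  proof -
    from h_attained[OF that] obtain C where C: "C \<in> chains a" "card C = h a" by blast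
    have "finite C" "a \<in> C" using C(1) finite_subset[of C ?A] by (auto simp: chains_def)
    then have "card C > 0" using card_gt_0_iff by blast
    then show ?thesis using C small[of C] by (auto simp: chains_def)
  qed
  have h_less: "h a < h a'" if "a \<in># D" "a' \<in># D" "unnested_before a a'" for a a'
  proof -
    from h_attained[OF that(1)] obtain C where C: "C \<in> chains a" "card C = h a" by blast
    have less: "\<forall>c\<in>C. unnested_before c a'"
      using C(1) that(3) by (fastforce simp: chains_def unnested_before_def)
    have "insert a' C \<in> chains a'"
      using C(1) less that(2) by (auto simp: chains_def pairwise_unnested_def)
    then have "card (insert a' C) \<le> h a'" unfolding h_def using fin by (intro Max_ge) auto
    moreover have "a' \<notin> C" using less by (auto simp: unnested_before_def)
    moreover have "finite C" using C(1) finite_subset[of C ?A] by (auto simp: chains_def)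
    ultimately show ?thesis using C(2) by simp
  qed
  define Q where "Q = (\<lambda>m. {a \<in> ?A. h a = m}) ` h ` ?A"
  have "partition_on ?A Q"
    unfolding Q_def by (rule partition_onI) (auto simp: disjnt_def)
  moreover have "card Q \<le> k"
  proof -
    have "card Q \<le> card (h ` ?A)" unfolding Q_def by (intro card_image_le) auto
    also have "\<dots> \<le> card {1..k}" using h_range by (intro card_mono) auto
    finally show ?thesis by simp
  qed
  moreover have "weak_nesting A" if "A \<in> Q" for A
    unfolding weak_nesting_def
  proof (intro ballI)
    fix a a' assume "a \<in> A" "a' \<in> A"
    then have "a \<in># D" "a' \<in># D" "h a = h a'" using that by (auto simp: Q_def)
    then show "weakly_nested a a'"
      using h_less[of a a'] h_less[of a' a] weakly_nested_iff[OF D] by auto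
  qed
  ultimately show ?thesis unfolding decomposable_into_weak_nestings_def by blast
qed

text \<open>
  The first vertex whose partner changes is the left end of the first arc in \<open>C\<close> whose right end is
  moved. Its new partner is the right end of a later arc of \<open>C\<close>, so it lies further to the right.
\<close>

lemma relabel_increases:
  assumes D: "matching P D" and C: "C \<subseteq> set_mset D" "pairwise_unnested C"
    and \<tau>: "\<tau> permutes snd ` C" "\<tau> \<noteq> id"
  shows "less_fun (partner D) (partner (relabel \<tau> D))"
proof -
  let ?K = "snd ` C"
  have KP: "?K \<subseteq> P" using C(1) matching_arc(3)[OF D] by auto
  then have \<tau>P: "\<tau> permutes P" using \<tau>(1) permutes_subset by blast
  have finC: "finite C" using C(1) finite_subset by blast
  define bad where "bad = {a \<in> C. \<tau> (snd a) \<noteq> snd a}"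
  have "bad \<noteq> {}"
  proof
    assume "bad = {}"
    then have "\<tau> x = x" for x
      using permutes_not_in[OF \<tau>(1), of x] by (cases "x \<in> snd ` C") (auto simp: bad_def)
    then show False using \<tau>(2) by auto
  qed
  moreover have finbad: "finite bad" using finC by (auto simp: bad_def)
  ultimately have "Min (fst ` bad) \<in> fst ` bad" by (intro Min_in) auto
  then obtain a where a1: "a \<in> bad" "fst a = Min (fst ` bad)" by fastforce
  have "fst a \<le> fst a'" if "a' \<in> bad" for a'
    unfolding a1(2) using finbad that by (intro Min_le) auto
  note a = a1(1) this
  obtain i j where ij: "a = (i, j)" by fastforce
  have aC: "(i, j) \<in> C" and bad: "\<tau> j \<noteq> j" using a(1) ij by (auto simp: bad_def)
  have aD: "(i, j) \<in># D" using aC C(1) by blast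
  \<comment> \<open>In a matching, no vertex is both a left end and a right end, so \<open>\<tau>\<close> fixes the left ends.\<close>
  have openers: "fst c \<notin> ?K" if "c \<in> C" for c
  proof
    assume "fst c \<in> ?K"
    then obtain c' where c': "c' \<in> C" "fst c = snd c'" by blast
    then have "c = c'" using matching_arc_unique[OF D, of c c' "fst c"] that C(1) by auto
    moreover have "(fst c, snd c) \<in># D" using that C(1) by auto
    then have "fst c < snd c" by (rule matching_arc(1)[OF D])
    ultimately show False using c'(2) by simp
  qed
  have small: "\<tau> (snd c) = snd c" if "c \<in> C" "fst c < i" for c
    using a(2)[of c] that ij by (auto simp: bad_def)
  have order: "fst c < fst c' \<longleftrightarrow> snd c < snd c'" if "c \<in> C" "c' \<in> C" for c c'
    using C(2)[unfolded pairwise_unnested_def unnested_before_def, rule_format, OF that]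
    by (cases "c = c'") auto
  show ?thesis
  proof (rule less_funI, intro exI[of _ i] conjI allI impI)
    have "\<tau> i = i" using openers[OF aC] permutes_not_in[OF \<tau>(1)] by simp
    then have eq: "partner (relabel \<tau> D) i = \<tau> j"
      using partner_relabel[OF D \<tau>P, of i] partner_eqI[OF D, of i j] aD by simp
    have "\<tau> j \<in> ?K" using permutes_in_image[OF \<tau>(1), of j] aC by force
    then obtain c where c: "c \<in> C" "\<tau> j = snd c" by blast
    have "\<not> snd c < j"
    proof
      assume "snd c < j"
      then have "fst c < i" using order[OF c(1) aC] by simp
      then have "\<tau> (\<tau> j) = \<tau> j" using small c by simp
      then show False using bad injD[OF permutes_inj[OF \<tau>(1)]] by blast
    qed
    then have "j < \<tau> j" using c(2) bad by simp
    then show "partner D i < partner (relabel \<tau> D) i"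
      using eq partner_eqI[OF D, of i j] aD by simp
  next
    fix y assume y: "y < i"
    have fix1: "\<tau> y = y"
    proof (cases "y \<in> ?K")
      case True
      then obtain c where c: "c \<in> C" "y = snd c" by blast
      have "i < j" using matching_arc(1)[OF D aD] .
      then have "snd c < j" using c y by simp
      then have "fst c < i" using order[OF c(1) aC] by simp
      then show ?thesis using small c by simp
    qed (simp add: permutes_not_in[OF \<tau>(1)])
    have fix2: "\<tau> (partner D y) = partner D y"
    proof (cases "partner D y \<in> ?K")
      case True
      then obtain c where c: "c \<in> C" "partner D y = snd c" by blast
      have "fst c = y"
        using partner_eqI[OF D, of "snd c" "fst c"] partner_partner[OF D, of y] c C(1) by auto
      then show ?thesis using small c y by simp
    qed (simp add: permutes_not_in[OF \<tau>(1)])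
    show "partner D y = partner (relabel \<tau> D) y"
      using partner_relabel[OF D \<tau>P, of y] fix1 fix2 by simp
  qed
qed

text \<open>
  Let \<open>x\<close> be the first vertex with different partners. It is a left end in both matchings, and its
  partner in \<open>D'\<close> has the same colour and is still free in \<open>D\<close>. As the arcs of \<open>D\<close> of this colour are
  nested, the partner of \<open>x\<close> in \<open>D\<close> is the last free vertex of this colour.
\<close>

lemma nested_matching_is_largest:
  assumes D: "matching P D" and D': "matching P D'"
    and f: "\<And>i j. (i, j) \<in># D \<Longrightarrow> f i = f j" and f': "\<And>i j. (i, j) \<in># D' \<Longrightarrow> f i = f j"
    and nested: "\<And>a a'. a \<in># D \<Longrightarrow> a' \<in># D \<Longrightarrow> f (fst a) = f (fst a') \<Longrightarrow> weakly_nested a a'"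
    and "D' \<noteq> D"
  shows "less_fun (partner D') (partner D)"
proof -
  have "partner D' \<noteq> partner D" using matching_eqI[OF D' D] \<open>D' \<noteq> D\<close> by blast
  then have ex: "\<exists>x. partner D' x \<noteq> partner D x" by auto
  define x where "x = (LEAST x. partner D' x \<noteq> partner D x)"
  have x: "partner D' x \<noteq> partner D x" unfolding x_def using ex by (rule LeastI_ex)
  have below: "partner D' z = partner D z" if "z < x" for z
    using not_less_Least that unfolding x_def by blast
  have xP: "x \<in> P" using x partner_outside[OF D] partner_outside[OF D'] by metis
  define y y' where "y = partner D x" and "y' = partner D' x"
  have yy: "partner D y = x" "partner D' y' = x"
    using partner_partner[OF D] partner_partner[OF D'] by (simp_all add: y_def y'_def)
  have yy': "y \<noteq> y'" using x by (simp add: y_def y'_def)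
  have "x < y"
  proof (rule ccontr)
    assume "\<not> x < y"
    moreover have "x \<noteq> y"
      using partner_arc[OF D xP] matching_arc(1)[OF D, of x x] by (auto simp: y_def)
    ultimately have "partner D' y = x" using below yy by simp
    then show False using partner_partner[OF D', of y] yy' by (simp add: y'_def)
  qed
  have "x < y'"
  proof (rule ccontr)
    assume "\<not> x < y'"
    moreover have "x \<noteq> y'"
      using partner_arc[OF D' xP] matching_arc(1)[OF D', of x x] by (auto simp: y'_def)
    ultimately have "partner D y' = x" using below yy by simp
    then show False using partner_partner[OF D, of y'] yy' by (simp add: y_def)
  qed
  have arc: "(x, y) \<in># D" using matching_mem_iff[OF D] \<open>x < y\<close> by (simp add: y_def)
  have arc': "(x, y') \<in># D'" using matching_mem_iff[OF D'] \<open>x < y'\<close> by (simp add: y'_def)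
  have y'P: "y' \<in> P" using matching_arc[OF D' arc'] by simp
  define z where "z = partner D y'"
  have z: "(y', z) \<in># D \<or> (z, y') \<in># D" using partner_arc[OF D y'P] by (simp add: z_def)
  \<comment> \<open>Before \<open>x\<close> the matchings agree, so the partner of \<open>y'\<close> in \<open>D\<close> cannot lie there.\<close>
  have zx: "\<not> z < x"
  proof
    assume "z < x"
    then have "partner D' z = y'" using below partner_partner[OF D, of y'] by (simp add: z_def)
    then have "partner D' y' = z" using partner_partner[OF D', of z] by simp
    then show False using yy(2) \<open>z < x\<close> by simp
  qed
  have "f y' = f x" using f'[OF arc'] by simp
  from z have "y' < y"
  proof
    assume a: "(y', z) \<in># D"
    show ?thesis
      using nested[OF arc a] \<open>f y' = f x\<close> matching_arc(1)[OF D a] \<open>x < y'\<close> yy' by simp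
  next
    assume a: "(z, y') \<in># D"
    have "f z = f x" using f[OF a] \<open>f y' = f x\<close> by simp
    then have "weakly_nested (x, y) (z, y')" using nested[OF arc a] by simp
    moreover have "z \<noteq> x" using matching_arc_unique[OF D arc a, of x] yy' by auto
    ultimately show ?thesis using zx yy' by auto
  qed
  then show ?thesis
    using below by (auto intro!: less_funI exI[of _ x] simp: y_def y'_def)
qed

lemma decomposable_colouring:
  assumes "matching P D" "decomposable_into_weak_nestings k D"
  obtains f where "\<And>x. x \<in> P \<Longrightarrow> f x < k" "\<And>i j. (i, j) \<in># D \<Longrightarrow> f i = f j"
    "\<And>a a'. a \<in># D \<Longrightarrow> a' \<in># D \<Longrightarrow> f (fst a) = f (fst a') \<Longrightarrow> weakly_nested a a'"
proof -
  obtain Q where Q: "partition_on (set_mset D) Q" "card Q \<le> k" "\<forall>A\<in>Q. weak_nesting A"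
    using assms(2) by (auto simp: decomposable_into_weak_nestings_def)
  have "finite Q" using finite_elements[OF _ Q(1)] by simp
  then obtain h where h: "inj_on h Q" "h ` Q \<subseteq> {..<k}"
    using card_le_inj[of Q "{..<k}"] Q(2) by auto
  define part where "part a = (THE A. A \<in> Q \<and> a \<in> A)" for a
  have part: "part a \<in> Q \<and> a \<in> part a" if "a \<in># D" for a
  proof -
    have "a \<in> \<Union>Q" using that partition_onD1[OF Q(1)] by simp
    then obtain A where A: "A \<in> Q" "a \<in> A" by (rule UnionE)
    have "B = A" if "B \<in> Q \<and> a \<in> B" for B
      using disjointD[OF partition_onD2[OF Q(1)], of A B] A that by blast
    then have "part a = A" unfolding part_def using A by (intro the_equality) blast+
    then show ?thesis using A by simp
  qed
  define f where "f x = h (part (if x < partner D x then (x, partner D x) else (partner D x, x)))" for x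
  have f: "f i = h (part (i, j))" "f j = h (part (i, j))" if "(i, j) \<in># D" for i j
    using that matching_arc(1)[OF assms(1) that] partner_eqI[OF assms(1), of i j]
      partner_eqI[OF assms(1), of j i] by (auto simp: f_def)
  show ?thesis
  proof (rule that)
    show "f x < k" if "x \<in> P" for x
      using partner_arc[OF assms(1) that] f part h(2) by (metis image_subset_iff lessThan_iff)
    show "f i = f j" if "(i, j) \<in># D" for i j
      using f[OF that] by simp
    show "weakly_nested a a'" if "a \<in># D" "a' \<in># D" "f (fst a) = f (fst a')" for a a'
    proof -
      have "h (part a) = h (part a')"
        using f(1)[of "fst a" "snd a"] f(1)[of "fst a'" "snd a'"] that by simp
      then have "part a = part a'" using h(1) part that by (meson inj_onD)
      then show ?thesis using part[OF that(1)] part[OF that(2)] Q(3) by (auto simp: weak_nesting_def)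
    qed
  qed
qed

lemma ex_matching:
  assumes "even n"
  shows "\<exists>D. matching {1..n} D"
proof -
  have "\<exists>D. matching {1..2 * m} D" for m
  proof (induction m)
    case 0
    then show ?case by (auto simp: matching_empty_iff intro!: exI[of _ "{#}"])
  next
    case (Suc m)
    then obtain D where D: "matching {1..2 * m} D" by blast
    have "{1..2 * Suc m} - {2 * m + 1, 2 * m + 2} = {1..2 * m}" by auto
    then have "matching {1..2 * Suc m} (add_mset (2 * m + 1, 2 * m + 2) D)"
      using D by (simp add: matching_add_mset_iff)
    then show ?case by blast
  qed
  then show ?thesis using assms by (metis evenE)
qed


section \<open>Invariant multilinear forms and the forms of matchings\<close>

context symmetric_bilinear_space
begin

lemma form_linear_simps:
  "b x (y + z) = b x y + b x z" "b (x + y) z = b x z + b y z"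
  "b x (c *s y) = c * b x y" "b (c *s x) y = c * b x y"
  "b x (y - z) = b x y - b x z" "b (x - y) z = b x z - b y z"
  "b x 0 = 0" "b 0 x = 0" "b x (- y) = - b x y" "b (- x) y = - b x y"
proof -
  have l: "Vector_Spaces.linear (*s) (*) (b x)" for x by (rule linear_right)
  have add: "b x (y + z) = b x y + b x z" for x y z
    using l[of x] by (simp add: Vector_Spaces.linear_iff)
  have sc: "b x (c *s y) = c * b x y" for x y c
    using l[of x] by (simp add: Vector_Spaces.linear_iff)
  have neg: "b x (- y) = - b x y" for x y using sc[of x "-1" y] by simp
  have diff: "b x (y - z) = b x y - b x z" for x y z using add[of x y "- z"] neg by simp
  have z: "b x 0 = 0" for x using sc[of x 0 0] by simp
  show "b x (y + z) = b x y + b x z" "b x (c *s y) = c * b x y" "b x (- y) = - b x y"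
    "b x (y - z) = b x y - b x z" "b x 0 = 0"
    by (fact add sc neg diff z)+
  show "b (x + y) z = b x z + b y z" "b (c *s x) y = c * b x y" "b (- x) y = - b x y"
    "b (x - y) z = b x z - b y z" "b 0 x = 0"
    using add[of z x y] sc[of y c x] neg[of y x] diff[of z x y] z[of x] by (simp_all only: symmetric)
qed

lemma form_sum_right: "b x (\<Sum>i\<in>I. f i) = (\<Sum>i\<in>I. b x (f i))"
  by (induction I rule: infinite_finite_induct) (auto simp: form_linear_simps)

lemma form_sum_left: "b (\<Sum>i\<in>I. f i) x = (\<Sum>i\<in>I. b (f i) x)"
  using form_sum_right[of x f I] by (simp only: symmetric)

lemma form_add_self: "b (x + y) (x + y) = b x x + b y y + 2 * b x y"
  using symmetric[of x y] by (simp add: form_linear_simps)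

lemma orthonormal_independent:
  assumes "\<And>x y. x \<in> E \<Longrightarrow> y \<in> E \<Longrightarrow> b x y = (if x = y then 1 else 0)"
  shows "independent E"
proof (unfold independent_explicit_finite_subsets, intro allI impI ballI)
  fix S u v assume S: "S \<subseteq> E" "finite S" and z: "(\<Sum>x\<in>S. u x *s x) = 0" and v: "v \<in> S"
  have "0 = b (\<Sum>x\<in>S. u x *s x) v" unfolding z by (simp add: form_linear_simps)
  also have "\<dots> = (\<Sum>x\<in>S. u x * (if x = v then 1 else 0))"
    unfolding form_sum_left using S v
    by (intro sum.cong refl) (simp add: form_linear_simps assms subset_iff)
  also have "\<dots> = u v" using S v by (simp add: sum.delta if_distrib cong: if_cong)
  finally show "u v = 0" by simp
qed

text \<open>
  A maximal orthonormal set is a basis: on its orthogonal complement every vector is isotropic, as it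
  could otherwise be normalised (complex numbers have square roots) and added, so \<open>b\<close> vanishes there by
  polarisation, and the complement is \<open>0\<close> by nondegeneracy.
\<close>

lemma ex_orthonormal_frame:
  obtains e where
    "\<And>i j. i < dim UNIV \<Longrightarrow> j < dim UNIV \<Longrightarrow> b (e i) (e j) = (if i = j then 1 else 0)"
    "\<And>x. x = (\<Sum>a<dim UNIV. b x (e a) *s e a)"
proof -
  obtain B0 where B0: "finite B0" "span B0 = UNIV" using finite_dim by blast
  define orthonormal where
    "orthonormal E \<longleftrightarrow> (\<forall>x\<in>E. \<forall>y\<in>E. b x y = (if x = y then 1 else 0))" for E
  have bound: "finite E \<and> card E \<le> card B0" if "orthonormal E" for E
    using independent_span_bound[of B0 E] orthonormal_independent[of E] that B0
    by (auto simp: orthonormal_def)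
  have "orthonormal {}" by (simp add: orthonormal_def)
  moreover have "\<forall>E. orthonormal E \<longrightarrow> card E < Suc (card B0)"
    using bound by (auto simp: less_Suc_eq_le)
  ultimately have "\<exists>E. orthonormal E \<and> (\<forall>E'. orthonormal E' \<longrightarrow> card E' \<le> card E)"
    by (rule ex_has_greatest_nat)
  then obtain E where E: "orthonormal E" "\<And>E'. orthonormal E' \<Longrightarrow> card E' \<le> card E"
    by blast
  have finE: "finite E" using bound E(1) by blast
  define \<pi> where "\<pi> x = (\<Sum>a\<in>E. b x a *s a)" for x
  have perp: "b (x - \<pi> x) a = 0" if "a \<in> E" for x a
  proof -
    have "b (\<pi> x) a = (\<Sum>c\<in>E. b x c * (if c = a then 1 else 0))"
      unfolding \<pi>_def form_sum_left using E(1) that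
      by (intro sum.cong) (auto simp: form_linear_simps orthonormal_def)
    also have "\<dots> = b x a" using finE that by (simp add: if_distrib cong: if_cong)
    finally show ?thesis by (simp add: form_linear_simps)
  qed
  have isotropic: "b w w = 0" if w: "\<And>a. a \<in> E \<Longrightarrow> b w a = 0" for w
  proof (rule ccontr)
    assume nz: "b w w \<noteq> 0"
    define u where "u = (1 / csqrt (b w w)) *s w"
    have "(1 / csqrt (b w w)) * (1 / csqrt (b w w)) * b w w = b w w / (csqrt (b w w))\<^sup>2"
      by (simp add: power2_eq_square)
    then have uu: "b u u = 1"
      using nz unfolding u_def by (simp add: form_linear_simps)
    have ua: "b u a = 0" "b a u = 0" if "a \<in> E" for a
      using w[OF that] symmetric[of a u] unfolding u_def by (simp_all add: form_linear_simps)
    have "u \<notin> E" using uu ua by force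
    then have "card (insert u E) = Suc (card E)" using finE by simp
    moreover have "orthonormal (insert u E)"
      using E(1) uu ua \<open>u \<notin> E\<close> unfolding orthonormal_def by auto
    ultimately show False using E(2)[of "insert u E"] by simp
  qed
  have expand: "x = \<pi> x" for x
  proof -
    have "x - \<pi> x = 0"
    proof (rule nondegenerate)
      fix y
      have "b (x - \<pi> x) (y - \<pi> y) = 0"
      proof -
        let ?x = "x - \<pi> x" and ?y = "y - \<pi> y"
        have "b (?x + ?y) (?x + ?y) = 0"
          using perp by (intro isotropic) (simp add: form_linear_simps(2))
        moreover have "b ?x ?x = 0" "b ?y ?y = 0" using perp by (auto intro!: isotropic)
        ultimately show ?thesis unfolding form_add_self by simp
      qed
      moreover have "b (x - \<pi> x) (\<pi> y) = 0"
        unfolding \<pi>_def[of y] form_sum_right using perp by (simp add: form_linear_simps(3))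
      ultimately show "b (x - \<pi> x) y = 0"
        using form_linear_simps(5)[of "x - \<pi> x" y "\<pi> y"] by simp
    qed
    then show ?thesis by simp
  qed
  have "span E = UNIV"
  proof -
    have "\<pi> x \<in> span E" for x
      unfolding \<pi>_def by (intro span_sum span_scale span_base)
    then show ?thesis using expand by (metis UNIV_eq_I)
  qed
  then have card: "dim UNIV = card E"
    using orthonormal_independent[of E] E(1) by (intro dim_eq_card) (auto simp: orthonormal_def)
  obtain e where e: "bij_betw e {..<card E} E"
    using ex_bij_betw_nat_finite[OF finE] by (auto simp: atLeast0LessThan)
  show ?thesis
  proof (rule that[of e])
    show "b (e i) (e j) = (if i = j then 1 else 0)" if "i < dim UNIV" "j < dim UNIV" for i j
    proof -
      have "e i \<in> E" "e j \<in> E" "e i = e j \<longleftrightarrow> i = j"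
        using bij_betw_apply[OF e] inj_on_eq_iff[OF bij_betw_imp_inj_on[OF e]] that by (simp_all add: card)
      then show ?thesis using E(1) by (simp add: orthonormal_def)
    qed
    show "x = (\<Sum>a<dim UNIV. b x (e a) *s e a)" for x
      using expand[of x] sum.reindex_bij_betw[OF e, of "\<lambda>a. b x a *s a"] by (simp add: card \<pi>_def)
  qed
qed

text \<open>
  The forms of \<open>tensor_power scale n\<close> for \<open>P = {1..n}\<close>; contractions lead to other sets of slots.
\<close>

definition multilinear_on :: "nat set \<Rightarrow> ((nat \<Rightarrow> 'v) \<Rightarrow> complex) \<Rightarrow> bool" where
  "multilinear_on P F \<longleftrightarrow>
    (\<forall>v w. (\<forall>i\<in>P. v i = w i) \<longrightarrow> F v = F w) \<and>
    (\<forall>i\<in>P. \<forall>v x y. F (v(i := x + y)) = F (v(i := x)) + F (v(i := y))) \<and>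
    (\<forall>i\<in>P. \<forall>v c x. F (v(i := c *s x)) = c * F (v(i := x)))"

lemma multilinear_onD:
  assumes "multilinear_on P F"
  shows "(\<And>i. i \<in> P \<Longrightarrow> v i = w i) \<Longrightarrow> F v = F w"
    and "i \<in> P \<Longrightarrow> F (v(i := x + y)) = F (v(i := x)) + F (v(i := y))"
    and "i \<in> P \<Longrightarrow> F (v(i := c *s x)) = c * F (v(i := x))"
  using assms unfolding multilinear_on_def by blast+

lemma multilinear_onI:
  assumes "\<And>v w. (\<And>i. i \<in> P \<Longrightarrow> v i = w i) \<Longrightarrow> F v = F w"
    and "\<And>i v x y. i \<in> P \<Longrightarrow> F (v(i := x + y)) = F (v(i := x)) + F (v(i := y))"
    and "\<And>i v c x. i \<in> P \<Longrightarrow> F (v(i := c *s x)) = c * F (v(i := x))"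
  shows "multilinear_on P F"
  using assms unfolding multilinear_on_def by blast

lemma multilinear_on_zero:
  assumes "multilinear_on P F" "i \<in> P"
  shows "F (v(i := 0)) = 0"
  using multilinear_onD(3)[OF assms, of v 0 0] by simp

lemma multilinear_on_sum:
  assumes "multilinear_on P F" "i \<in> P"
  shows "F (v(i := (\<Sum>a\<in>A. f a))) = (\<Sum>a\<in>A. F (v(i := f a)))"
  by (induction A rule: infinite_finite_induct)
    (simp_all add: multilinear_on_zero[OF assms] multilinear_onD(2)[OF assms] del: fun_upd_apply)

lemma tensor_power_iff: "F \<in> tensor_power scale n \<longleftrightarrow> multilinear_on {1..n} F"
proof -
  have "vector_space ((*) :: complex \<Rightarrow> complex \<Rightarrow> complex)"
    by unfold_locales (auto simp: algebra_simps)
  then show ?thesis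
    unfolding tensor_power_def multilinear_map_def multilinear_on_def Vector_Spaces.linear_iff
    using vector_space_axioms by blast
qed

lemma subspace_multilinear_on: "forms.subspace {F. multilinear_on P F}"
proof (rule subspaceI_fun)
  show "(\<lambda>v. 0) \<in> {F. multilinear_on P F}" by (simp add: multilinear_on_def)
next
  fix F G assume "F \<in> {F. multilinear_on P F}" "G \<in> {F. multilinear_on P F}"
  then have FG: "multilinear_on P F" "multilinear_on P G" by auto
  have "multilinear_on P (\<lambda>v. F v + G v)"
  proof (rule multilinear_onI, goal_cases)
    case (1 v w)
    then show ?case
      using multilinear_onD(1)[OF FG(1), of v w] multilinear_onD(1)[OF FG(2), of v w] by simp
  qed (simp_all add: multilinear_onD(2,3)[OF FG(1)] multilinear_onD(2,3)[OF FG(2)] algebra_simps)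
  then show "(\<lambda>v. F v + G v) \<in> {F. multilinear_on P F}" by simp
next
  fix c F assume "F \<in> {F. multilinear_on P F}"
  then have F: "multilinear_on P F" by auto
  have "multilinear_on P (\<lambda>v. c * F v)"
  proof (rule multilinear_onI, goal_cases)
    case (1 v w)
    then show ?case using multilinear_onD(1)[OF F, of v w] by simp
  qed (simp_all add: multilinear_onD(2,3)[OF F] algebra_simps)
  then show "(\<lambda>v. c * F v) \<in> {F. multilinear_on P F}" by simp
qed

lemma multilinear_on_permute:
  assumes F: "multilinear_on P F" and \<sigma>: "\<sigma> permutes P"
  shows "multilinear_on P (\<lambda>v. F (v \<circ> \<sigma>))"
proof -
  have upd: "v(i := x) \<circ> \<sigma> = (v \<circ> \<sigma>)(inv \<sigma> i := x)" for v :: "nat \<Rightarrow> 'v" and i x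
    using permutes_inverses[OF \<sigma>] by (auto simp: fun_eq_iff)
  have "inv \<sigma> i \<in> P" if "i \<in> P" for i
    using permutes_in_image[OF permutes_inv[OF \<sigma>]] that by simp
  then show ?thesis
    using permutes_in_image[OF \<sigma>]
    by (intro multilinear_onI) (auto simp: upd multilinear_onD(2,3)[OF F] intro!: multilinear_onD(1)[OF F])
qed

abbreviation orthogonal :: "('v \<Rightarrow> 'v) set" where
  "orthogonal \<equiv> orthogonal_group scale b"

definition invariant_forms :: "nat set \<Rightarrow> ((nat \<Rightarrow> 'v) \<Rightarrow> complex) set" where
  "invariant_forms P = {F. multilinear_on P F \<and> (\<forall>g\<in>orthogonal. \<forall>v. F (\<lambda>i. g (v i)) = F v)}"

lemma orthogonalD:
  assumes "g \<in> orthogonal"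
  shows "b (g x) (g y) = b x y" "g (inv g x) = x" "inv g (g x) = x"
    "g (x + y) = g x + g y" "g (c *s x) = c *s g x"
  using assms by (auto simp: orthogonal_group_def bij_is_surj surj_f_inv_f bij_is_inj Vector_Spaces.linear_iff)

lemma orthogonal_inv:
  assumes "g \<in> orthogonal"
  shows "inv g \<in> orthogonal"
proof -
  have bij: "bij g" using assms by (simp add: orthogonal_group_def)
  have "inv g (x + y) = inv g x + inv g y" for x y
    by (metis orthogonalD(2-4)[OF assms])
  moreover have "inv g (c *s x) = c *s inv g x" for c x
    by (metis orthogonalD(2,3,5)[OF assms])
  moreover have "b (inv g x) (inv g y) = b x y" for x y
    by (metis orthogonalD(1,2)[OF assms])
  ultimately show ?thesis
    using bij_imp_bij_inv[OF bij] vector_space_axioms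
    by (simp add: orthogonal_group_def Vector_Spaces.linear_iff)
qed

text \<open>
  The action uses \<open>inv g\<close>; as \<open>g\<close> runs over a group, \<open>g\<close> itself may be used instead.
\<close>

lemma tensor_invariants_eq: "tensor_invariants scale b n = invariant_forms {1..n}"
proof -
  have "(\<forall>g\<in>orthogonal. tensor_action g F = F) \<longleftrightarrow> (\<forall>g\<in>orthogonal. \<forall>v. F (\<lambda>i. g (v i)) = F v)" for F
  proof (intro iffI ballI allI)
    fix g v assume "\<forall>g\<in>orthogonal. tensor_action g F = F" and g: "g \<in> orthogonal"
    then have "tensor_action (inv g) F v = F v" using orthogonal_inv by simp
    moreover have "inv (inv g) = g" using g by (simp add: orthogonal_group_def inv_inv_eq)
    ultimately show "F (\<lambda>i. g (v i)) = F v" by (simp add: tensor_action_def)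
  next
    fix g assume "\<forall>g\<in>orthogonal. \<forall>v. F (\<lambda>i. g (v i)) = F v" and g: "g \<in> orthogonal"
    then show "tensor_action g F = F" using orthogonal_inv[OF g] by (auto simp: tensor_action_def)
  qed
  then show ?thesis
    by (auto simp: tensor_invariants_def invariant_forms_def tensor_power_iff)
qed

lemma invariant_formsD:
  assumes "F \<in> invariant_forms P"
  shows "multilinear_on P F" "g \<in> orthogonal \<Longrightarrow> F (\<lambda>i. g (v i)) = F v"
  using assms by (auto simp: invariant_forms_def)

lemma invariant_formsI:
  assumes "multilinear_on P F" "\<And>g v. g \<in> orthogonal \<Longrightarrow> F (\<lambda>i. g (v i)) = F v"
  shows "F \<in> invariant_forms P"
  using assms by (auto simp: invariant_forms_def)

lemma subspace_invariant_forms: "forms.subspace (invariant_forms P)"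
  using subspace_multilinear_on[of P]
  by (intro subspaceI_fun invariant_formsI)
    (auto dest!: invariant_formsD intro: subspace_zero subspace_plus subspace_times
      simp: invariant_formsD(2) forms.subspace_def scale_form_def zero_fun_def plus_fun_def)

lemma invariant_forms_permute:
  assumes "F \<in> invariant_forms P" "\<sigma> permutes P"
  shows "(\<lambda>v. F (v \<circ> \<sigma>)) \<in> invariant_forms P"
proof (rule invariant_formsI)
  show "multilinear_on P (\<lambda>v. F (v \<circ> \<sigma>))"
    using invariant_formsD(1)[OF assms(1)] assms(2) by (rule multilinear_on_permute)
  show "F ((\<lambda>i. g (v i)) \<circ> \<sigma>) = F (v \<circ> \<sigma>)" if "g \<in> orthogonal" for g v
    using invariant_formsD(2)[OF assms(1) that, of "v \<circ> \<sigma>"] by (simp add: o_def)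
qed

lemma invariant_forms_antisymmetrize:
  assumes "F \<in> invariant_forms P" "K \<subseteq> P"
  shows "antisymmetrize K F \<in> invariant_forms P"
  unfolding antisymmetrize_def
  using permutes_subset[OF _ assms(2)]
  by (intro subspace_sum_fun subspace_times subspace_invariant_forms invariant_forms_permute[OF assms(1)]) simp

lemma diagram_form_add_mset:
  "diagram_form b (add_mset (i, j) D) = (\<lambda>v. b (v i) (v j) * diagram_form b D v)"
  by (simp add: diagram_form_def contraction_def)

lemma diagram_form_empty: "diagram_form b {#} = (\<lambda>v. 1)"
  by (simp add: diagram_form_def)

lemma contraction_times_invariant_form:
  assumes G: "G \<in> invariant_forms (P - {i, j})" and ij: "i \<in> P" "j \<in> P" "i \<noteq> j"
  shows "(\<lambda>v. b (v i) (v j) * G v) \<in> invariant_forms P"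
proof (rule invariant_formsI)
  note lin = multilinear_onD[OF invariant_formsD(1)[OF G]]
  have indep: "G (v(l := x)) = G v" if "l \<in> {i, j}" for v l x
    using that by (intro lin(1)) auto
  show "multilinear_on P (\<lambda>v. b (v i) (v j) * G v)"
  proof (rule multilinear_onI)
    fix v w :: "nat \<Rightarrow> 'v" assume "\<And>i. i \<in> P \<Longrightarrow> v i = w i"
    then have "v i = w i" "v j = w j" "G v = G w" using ij by (auto intro!: lin(1))
    then show "b (v i) (v j) * G v = b (w i) (w j) * G w" by simp
  next
    fix l v x y assume "l \<in> P"
    then show "b ((v(l := x + y)) i) ((v(l := x + y)) j) * G (v(l := x + y)) =
      b ((v(l := x)) i) ((v(l := x)) j) * G (v(l := x)) + b ((v(l := y)) i) ((v(l := y)) j) * G (v(l := y))"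
      using ij(3) by (cases "l \<in> {i, j}")
        (auto simp: form_linear_simps indep lin(2) algebra_simps)
  next
    fix l v c x assume "l \<in> P"
    then show "b ((v(l := c *s x)) i) ((v(l := c *s x)) j) * G (v(l := c *s x)) =
      c * (b ((v(l := x)) i) ((v(l := x)) j) * G (v(l := x)))"
      using ij(3) by (cases "l \<in> {i, j}")
        (auto simp: form_linear_simps indep lin(3) algebra_simps)
  qed
  show "b (g (v i)) (g (v j)) * G (\<lambda>i. g (v i)) = b (v i) (v j) * G v" if "g \<in> orthogonal" for g v
    using orthogonalD(1)[OF that] invariant_formsD(2)[OF G that] by simp
qed

lemma diagram_form_invariant:
  assumes "matching P D"
  shows "diagram_form b D \<in> invariant_forms P"
  using assms
proof (induction D arbitrary: P)
  case empty
  then show ?case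
    by (intro invariant_formsI) (auto simp: matching_empty_iff diagram_form_empty multilinear_on_def)
next
  case (add a D)
  obtain i j where a: "a = (i, j)" by fastforce
  show ?case
    using add contraction_times_invariant_form[of "diagram_form b D" P i j]
    by (simp add: a matching_add_mset_iff diagram_form_add_mset)
qed

lemma diagram_form_relabel: "diagram_form b (relabel \<tau> D) v = diagram_form b D (v \<circ> \<tau>)"
proof (induction D)
  case (add a D)
  obtain i j where a: "a = (i, j)" by fastforce
  show ?case using add symmetric[of "v (\<tau> i)" "v (\<tau> j)"]
    by (auto simp: a relabel_def diagram_form_add_mset min_def max_def)
qed (simp add: relabel_def diagram_form_empty)

definition matching_span :: "nat set \<Rightarrow> ((nat \<Rightarrow> 'v) \<Rightarrow> complex) set" where
  "matching_span P = forms.span (diagram_form b ` {D. matching P D})"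

lemma subspace_matching_span: "forms.subspace (matching_span P)"
  unfolding matching_span_def by (rule forms.subspace_span)

lemma contraction_times_matching_span:
  assumes G: "G \<in> matching_span (P - {i, j})" and ij: "i \<in> P" "j \<in> P" "i \<noteq> j"
  shows "(\<lambda>v. b (v i) (v j) * G v) \<in> matching_span P"
proof -
  let ?S = "{G. (\<lambda>v. b (v i) (v j) * G v) \<in> matching_span P}"
  note sub = subspace_matching_span[of P]
  have "forms.subspace ?S"
  proof (rule subspaceI_fun)
    show "(\<lambda>v. 0) \<in> ?S" using subspace_zero[OF sub] by simp
    show "(\<lambda>v. F v + G v) \<in> ?S" if "F \<in> ?S" "G \<in> ?S" for F G
      using subspace_plus[OF sub, of "\<lambda>v. b (v i) (v j) * F v" "\<lambda>v. b (v i) (v j) * G v"] that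
      by (simp add: algebra_simps)
    show "(\<lambda>v. c * F v) \<in> ?S" if "F \<in> ?S" for c F
      using subspace_times[OF sub, of "\<lambda>v. b (v i) (v j) * F v" c] that
      by (simp add: algebra_simps)
  qed
  moreover have "diagram_form b D \<in> ?S" if D: "matching (P - {i, j}) D" for D
  proof -
    define D' where "D' = add_mset (min i j, max i j) D"
    have "{min i j, max i j} = {i, j}" by (auto simp: min_def max_def)
    then have "matching P D'"
      using D ij by (auto simp: D'_def matching_add_mset_iff min_def max_def insert_commute)
    moreover have "diagram_form b D' = (\<lambda>v. b (v i) (v j) * diagram_form b D v)"
      using symmetric by (auto simp: D'_def diagram_form_add_mset min_def max_def)
    moreover have "diagram_form b D' \<in> matching_span P" if "matching P D'"
      unfolding matching_span_def using that by (intro forms.span_base) blast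
    ultimately show ?thesis by simp
  qed
  ultimately have "matching_span (P - {i, j}) \<subseteq> ?S"
    unfolding matching_span_def by (intro forms.span_minimal) auto
  then show ?thesis using G by blast
qed

end


section \<open>The first fundamental theorem\<close>

locale orthonormal_frame = symmetric_bilinear_space scale b
  for scale :: "complex \<Rightarrow> 'v::ab_group_add \<Rightarrow> 'v"  (infixr \<open>*s\<close> 75) and b +
  fixes k :: nat and e :: "nat \<Rightarrow> 'v"
  assumes orthonormal: "\<And>i j. i < k \<Longrightarrow> j < k \<Longrightarrow> b (e i) (e j) = (if i = j then 1 else 0)"
    and frame_expand: "\<And>x. x = (\<Sum>a<k. b x (e a) *s e a)"
begin

lemma form_expand: "b x y = (\<Sum>a<k. b x (e a) * b y (e a))"
proof -
  have "b x y = b x (\<Sum>a<k. b y (e a) *s e a)" using frame_expand[of y] by simp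
  then show ?thesis by (simp add: form_sum_right form_linear_simps mult.commute)
qed

lemma slot_expand:
  assumes "multilinear_on P F" "q \<in> P"
  shows "F v = (\<Sum>a<k. b (v q) (e a) * F (v(q := e a)))"
proof -
  have "F v = F (v(q := (\<Sum>a<k. b (v q) (e a) *s e a)))" using frame_expand[of "v q"] by simp
  then show ?thesis by (simp only: multilinear_on_sum[OF assms] multilinear_onD(3)[OF assms])
qed

lemma multilinear_on_eq_zeroI:
  assumes F: "multilinear_on P F" and fin: "finite P"
    and zero: "\<And>J. (\<And>i. i \<in> P \<Longrightarrow> J i < k) \<Longrightarrow> F (\<lambda>i. e (J i)) = 0"
  shows "F v = 0"
proof -
  have "F v = 0" if "finite S" "S \<subseteq> P" "\<And>i. i \<in> P - S \<Longrightarrow> v i \<in> e ` {..<k}" for S v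
    using that
  proof (induction S arbitrary: v rule: finite_induct)
    case empty
    then have "\<forall>i\<in>P. \<exists>a. a < k \<and> v i = e a" by auto
    then obtain J where J: "\<And>i. i \<in> P \<Longrightarrow> J i < k \<and> v i = e (J i)" by metis
    then have "F v = F (\<lambda>i. e (J i))" by (intro multilinear_onD(1)[OF F]) simp
    then show ?case using zero[of J] J by simp
  next
    case (insert j S)
    have "F (v(j := e a)) = 0" if "a < k" for a
      using insert.prems that by (intro insert.IH) auto
    then show ?case using slot_expand[OF F, of j v] insert.prems(1) by simp
  qed
  from this[of P] show ?thesis using fin by simp
qed

lemma independent_frame: "independent (e ` {..<k})"
proof (rule orthonormal_independent)
  fix x y assume "x \<in> e ` {..<k}" "y \<in> e ` {..<k}"
  then obtain i j where ij: "x = e i" "y = e j" "i < k" "j < k" by auto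
  have "e i \<noteq> e j" if "i \<noteq> j"
    using orthonormal[of i i] orthonormal[of i j] ij(3,4) that by auto
  then show "b x y = (if x = y then 1 else 0)" using orthonormal ij by auto
qed

lemma span_frame: "span (e ` {..<k}) = UNIV"
proof -
  have "(\<Sum>a<k. b x (e a) *s e a) \<in> span (e ` {..<k})" for x
    by (intro span_sum span_scale span_base) auto
  then show ?thesis using frame_expand by (metis UNIV_eq_I)
qed

text \<open>
  A linear isometry is injective as \<open>b\<close> is nondegenerate, hence bijective in finite dimension.
\<close>

lemma isometry_orthogonal:
  assumes add: "\<And>x y. g (x + y) = g x + g y" and scale: "\<And>c x. g (c *s x) = c *s g x"
    and iso: "\<And>x y. b (g x) (g y) = b x y"
  shows "g \<in> orthogonal"
proof -
  interpret finite_dimensional_vector_space scale "e ` {..<k}"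
    using independent_frame span_frame by unfold_locales auto
  have lin: "Vector_Spaces.linear scale scale g"
    using add scale vector_space_axioms by (simp add: Vector_Spaces.linear_iff)
  have "inj g"
  proof (rule injI)
    fix x y assume "g x = g y"
    then have "b x z = b y z" for z using iso[of x z] iso[of y z] by simp
    then have "x - y = 0" by (intro nondegenerate) (simp add: form_linear_simps)
    then show "x = y" by simp
  qed
  then have "bij g" using linear_inj_imp_surj[OF lin] by (simp add: bij_def)
  then show ?thesis using lin iso by (simp add: orthogonal_group_def)
qed

lemma reflection_orthogonal:
  assumes "a < k"
  shows "(\<lambda>x. x - (2 * b x (e a)) *s e a) \<in> orthogonal"
proof (rule isometry_orthogonal)
  show "b (x - (2 * b x (e a)) *s e a) (y - (2 * b y (e a)) *s e a) = b x y" for x y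
    using orthonormal[OF assms assms] symmetric[of "e a" y]
    by (simp add: form_linear_simps algebra_simps)
qed (simp_all add: form_linear_simps algebra_simps)

lemma uminus_orthogonal: "uminus \<in> orthogonal"
  by (intro isometry_orthogonal) (auto simp: form_linear_simps)

lemma multilinear_homogeneous:
  assumes F: "multilinear_on P F" and "finite P"
  shows "F (\<lambda>i. c *s v i) = c ^ card P * F v"
proof -
  have "F (\<lambda>i. if i \<in> S then c *s v i else v i) = c ^ card S * F v" if "finite S" "S \<subseteq> P" for S
    using that
  proof (induction S rule: finite_induct)
    case (insert j S)
    let ?w = "\<lambda>i. if i \<in> S then c *s v i else v i"
    have "(\<lambda>i. if i \<in> insert j S then c *s v i else v i) = ?w(j := c *s v j)" by auto
    moreover have "?w(j := v j) = ?w" using insert.hyps by auto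
    ultimately show ?case
      using insert multilinear_onD(3)[OF F, of j ?w c "v j"] by (simp del: fun_upd_apply)
  qed simp
  from this[OF assms(2) subset_refl] multilinear_onD(1)[OF F, of "\<lambda>i. c *s v i" "\<lambda>i. if i \<in> P then c *s v i else v i"]
  show ?thesis by simp
qed

text \<open>
  The product rule along a curve that is quadratic in every slot; the quadratic terms do not
  contribute at \<open>t = 0\<close>. They are present because the rotations below, cleared of denominators, are
  quadratic in their parameter.
\<close>

lemma multilinear_derivative:
  assumes F: "multilinear_on P F" and "finite S" "S \<subseteq> P"
  shows "((\<lambda>t. F (\<lambda>i. if i \<in> S then v i + (t *s x i + t\<^sup>2 *s y i) else v i))
    has_field_derivative (\<Sum>i\<in>S. F (v(i := x i)))) (at 0)"
  using assms(2,3)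
proof (induction S arbitrary: v rule: finite_induct)
  case empty
  then show ?case by simp
next
  case (insert j S)
  have jP: "j \<in> P" and jS: "j \<notin> S" using insert by auto
  define u where "u w t = (\<lambda>i. if i \<in> S then w i + (t *s x i + t\<^sup>2 *s y i) else w i)" for w t
  have upd: "u (v(j := z)) t = (u v t)(j := z)" for z t using jS by (auto simp: u_def)
  have D: "((\<lambda>t. F (u w t)) has_field_derivative (\<Sum>i\<in>S. F (w(i := x i)))) (at 0)" for w
    unfolding u_def using insert.prems by (intro insert.IH) auto
  have split: "F (\<lambda>i. if i \<in> insert j S then v i + (t *s x i + t\<^sup>2 *s y i) else v i) =
      F (u v t) + (t * F (u (v(j := x j)) t) + t\<^sup>2 * F (u (v(j := y j)) t))" for t
  proof -
    have "(\<lambda>i. if i \<in> insert j S then v i + (t *s x i + t\<^sup>2 *s y i) else v i) =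
        (u v t)(j := v j + (t *s x j + t\<^sup>2 *s y j))"
      using jS by (auto simp: u_def)
    moreover have "(u v t)(j := v j) = u v t" using jS by (auto simp: u_def)
    ultimately show ?thesis
      by (simp add: multilinear_onD(2,3)[OF F jP] upd del: fun_upd_apply)
  qed
  have u0: "u w 0 = w" for w by (auto simp: u_def)
  have "((\<lambda>t. F (u v t) + (t * F (u (v(j := x j)) t) + t\<^sup>2 * F (u (v(j := y j)) t)))
    has_field_derivative (\<Sum>i\<in>S. F (v(i := x i))) + F (v(j := x j))) (at 0)"
    by (rule derivative_eq_intros D refl | simp add: u0)+
  then show ?case unfolding split using insert.hyps by (simp add: add.commute del: fun_upd_apply)
qed

text \<open>
  Invariance under the Lie algebra element that rotates the plane of \<open>e a\<close> and \<open>e c\<close>.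
\<close>

lemma infinitesimal_rotation:
  assumes F: "F \<in> invariant_forms P" and fin: "finite P" and ac: "a < k" "c < k"
  shows "(\<Sum>p\<in>P. b (v p) (e a) * F (v(p := e c)) - b (v p) (e c) * F (v(p := e a))) = 0"
proof (cases "a = c")
  case False
  note lin = invariant_formsD(1)[OF F]
  have ee: "b (e a) (e a) = 1" "b (e c) (e c) = 1" "b (e a) (e c) = 0" "b (e c) (e a) = 0"
    using orthonormal ac False by auto
  \<comment> \<open>With \<open>cos = (1 - t\<^sup>2) / (1 + t\<^sup>2)\<close> and \<open>sin = 2 * t / (1 + t\<^sup>2)\<close>, the map \<open>N t\<close> is \<open>1 + t\<^sup>2\<close> times
    the rotation of the plane of \<open>e a\<close> and \<open>e c\<close>. Its linear term \<open>X\<close> is the infinitesimal rotation.\<close>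
  define X where "X x = 2 *s (b x (e a) *s e c - b x (e c) *s e a)" for x
  define Y where "Y x = x - 2 *s (b x (e a) *s e a + b x (e c) *s e c)" for x
  define N where "N t x = x + (t *s X x + t\<^sup>2 *s Y x)" for t x
  have iso: "b (N t x) (N t y) = (1 + t\<^sup>2)\<^sup>2 * b x y" for t x y
    unfolding N_def X_def Y_def
    by (simp add: form_linear_simps symmetric[of "e a" y] symmetric[of "e c" y] ee
        power2_eq_square algebra_simps)
  have Nlin: "N t (x + y) = N t x + N t y" "N t (d *s x) = d *s N t x" for t x y d
    unfolding N_def X_def Y_def by (simp_all add: form_linear_simps algebra_simps)
  have rot: "F (\<lambda>i. N t (v i)) = (1 + t\<^sup>2) ^ card P * F v" if "1 + t\<^sup>2 \<noteq> 0" for t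
  proof -
    let ?r = "1 / (1 + t\<^sup>2)"
    have "b (?r *s N t x) (?r *s N t y) = b x y" for x y
      using that by (simp add: form_linear_simps iso power2_eq_square)
    then have "(\<lambda>x. ?r *s N t x) \<in> orthogonal"
      by (intro isometry_orthogonal) (simp_all add: Nlin scale_right_distrib mult.commute)
    from invariant_formsD(2)[OF F this, of v] have "?r ^ card P * F (\<lambda>i. N t (v i)) = F v"
      using multilinear_homogeneous[OF lin fin, of ?r "\<lambda>i. N t (v i)"] by simp
    then show ?thesis using that by (simp add: field_simps)
  qed
  have "((\<lambda>t. F (\<lambda>i. N t (v i))) has_field_derivative (\<Sum>p\<in>P. F (v(p := X (v p))))) (at 0)"
  proof -
    have "F (\<lambda>i. N t (v i)) =
        F (\<lambda>i. if i \<in> P then v i + (t *s X (v i) + t\<^sup>2 *s Y (v i)) else v i)" for t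
      by (intro multilinear_onD(1)[OF lin]) (simp add: N_def)
    then show ?thesis
      using multilinear_derivative[OF lin fin subset_refl, of v "\<lambda>i. X (v i)" "\<lambda>i. Y (v i)"] by simp
  qed
  moreover have "((\<lambda>t. F (\<lambda>i. N t (v i))) has_field_derivative 0) (at 0)"
  proof (rule has_field_derivative_transform_within[where d = 1])
    \<comment> \<open>The scaling factor contains no linear term in \<open>t\<close>.\<close>
    show "((\<lambda>t. (1 + t\<^sup>2) ^ card P * F v) has_field_derivative 0) (at 0)"
      by (rule derivative_eq_intros refl | simp)+
    show "(1 + t\<^sup>2) ^ card P * F v = F (\<lambda>i. N t (v i))" if "dist t 0 < 1" for t
    proof -
      have "norm (t\<^sup>2) < 1" using that by (simp add: norm_power power_less_one_iff)
      then have "t\<^sup>2 \<noteq> -1" by auto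
      then have "1 + t\<^sup>2 \<noteq> 0" by (metis add.commute add_eq_0_iff)
      then show ?thesis by (rule rot[symmetric])
    qed
  qed auto
  ultimately have sum0: "(\<Sum>p\<in>P. F (v(p := X (v p)))) = 0" by (rule DERIV_unique)
  have "F (v(p := X (v p))) =
      2 * (b (v p) (e a) * F (v(p := e c)) - b (v p) (e c) * F (v(p := e a)))" if "p \<in> P" for p
  proof -
    have "X x = (2 * b x (e a)) *s e c + (- 2 * b x (e c)) *s e a" for x
      by (simp add: X_def algebra_simps)
    then have "F (v(p := X (v p))) =
        2 * b (v p) (e a) * F (v(p := e c)) + - 2 * b (v p) (e c) * F (v(p := e a))"
      by (simp only: multilinear_onD(2,3)[OF lin that])
    then show ?thesis by (simp add: algebra_simps del: fun_upd_apply)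
  qed
  then have "(\<Sum>p\<in>P. 2 * (b (v p) (e a) * F (v(p := e c)) - b (v p) (e c) * F (v(p := e a)))) =
      (\<Sum>p\<in>P. F (v(p := X (v p))))"
    by (intro sum.cong refl) (rule sym)
  then have "(\<Sum>p\<in>P. 2 * (b (v p) (e a) * F (v(p := e c)) - b (v p) (e c) * F (v(p := e a)))) = 0"
    using sum0 by (rule trans)
  then show ?thesis unfolding sum_distrib_left[symmetric] by simp
qed simp

text \<open>
  The contraction of \<open>F\<close> with the dual \<open>\<Sum>a<k. e a \<otimes> e a\<close> of \<open>b\<close> in the slots \<open>p\<close> and \<open>q\<close>.
\<close>

definition trace_form :: "nat \<Rightarrow> nat \<Rightarrow> ((nat \<Rightarrow> 'v) \<Rightarrow> complex) \<Rightarrow> (nat \<Rightarrow> 'v) \<Rightarrow> complex" where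
  "trace_form p q F = (\<lambda>v. \<Sum>a<k. F (v(p := e a, q := e a)))"

text \<open>
  The tensor \<open>\<Sum>a<k. e a \<otimes> e a\<close> does not change when \<open>inv g\<close> is applied to both factors, because the
  images of an orthonormal basis form again one; this is the equation \<open>gram\<close> in the proof.
\<close>

lemma trace_form_invariant:
  assumes F: "F \<in> invariant_forms P" and pq: "p \<in> P" "q \<in> P" "p \<noteq> q"
  shows "trace_form p q F \<in> invariant_forms (P - {p, q})"
proof (rule invariant_formsI)
  note lin = invariant_formsD(1)[OF F]
  have swap: "v(i := x, p := y, q := z) = v(p := y, q := z, i := x)" if "i \<notin> {p, q}"
    for v :: "nat \<Rightarrow> 'v" and i x y z using that pq(3) by auto
  show "multilinear_on (P - {p, q}) (trace_form p q F)"
  proof (rule multilinear_onI, goal_cases)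
    case (1 v w)
    then show ?case
      unfolding trace_form_def by (intro sum.cong refl multilinear_onD(1)[OF lin]) simp
  next
    case (2 i v x y)
    then show ?case
      by (simp add: trace_form_def swap multilinear_onD(2)[OF lin] sum.distrib del: fun_upd_apply)
  next
    case (3 i v c x)
    then show ?case
      by (simp add: trace_form_def swap multilinear_onD(3)[OF lin] sum_distrib_left del: fun_upd_apply)
  qed
  show "trace_form p q F (\<lambda>i. g (v i)) = trace_form p q F v" if g: "g \<in> orthogonal" for g v
  proof -
    note h = orthogonalD[OF orthogonal_inv[OF g]]
    have two: "F (v(p := x, q := y)) =
        (\<Sum>c<k. \<Sum>d<k. b x (e c) * b y (e d) * F (v(p := e c, q := e d)))" for x y
    proof -
      have "F (v(p := x, q := y)) = (\<Sum>c<k. b x (e c) * F (v(p := e c, q := y)))"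
        using slot_expand[OF lin pq(1), of "v(p := x, q := y)"] pq(3)
        by (simp add: fun_upd_twist[of p q] )
      also have "\<dots> = (\<Sum>c<k. b x (e c) * (\<Sum>d<k. b y (e d) * F (v(p := e c, q := e d))))"
        using slot_expand[OF lin pq(2), of "v(p := e _, q := y)"] pq(3)
        by (intro sum.cong refl) (subst slot_expand[OF lin pq(2)], simp)
      finally show ?thesis by (simp add: sum_distrib_left mult.assoc)
    qed
    have gram: "(\<Sum>a<k. b (inv g (e a)) (e c) * b (inv g (e a)) (e d)) = (if c = d then 1 else 0)"
      if "c < k" "d < k" for c d
    proof -
      have move: "b (inv g (e a)) x = b (g x) (e a)" for a x
        using h(1)[of "e a" "g x"] orthogonalD(3)[OF g] symmetric by simp
      show ?thesis
        using form_expand[of "g (e c)" "g (e d)"] orthogonalD(1)[OF g] orthonormal[OF that]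
        by (simp add: move)
    qed
    have "trace_form p q F (\<lambda>i. g (v i)) = (\<Sum>a<k. F (v(p := inv g (e a), q := inv g (e a))))"
    proof -
      have "F ((\<lambda>i. g (v i))(p := e a, q := e a)) = F (v(p := inv g (e a), q := inv g (e a)))" for a
      proof -
        have "(\<lambda>i. g (v i))(p := e a, q := e a) = (\<lambda>i. g ((v(p := inv g (e a), q := inv g (e a))) i))"
          using orthogonalD(2)[OF g] by (auto simp: fun_eq_iff)
        then show ?thesis
          using invariant_formsD(2)[OF F g, of "v(p := inv g (e a), q := inv g (e a))"] by (simp only:)
      qed
      then show ?thesis by (simp add: trace_form_def)
    qed
    also have "\<dots> = (\<Sum>a<k. \<Sum>c<k. \<Sum>d<k.
        b (inv g (e a)) (e c) * b (inv g (e a)) (e d) * F (v(p := e c, q := e d)))"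
      by (intro sum.cong refl two)
    also have "\<dots> = (\<Sum>c<k. \<Sum>d<k. \<Sum>a<k.
        b (inv g (e a)) (e c) * b (inv g (e a)) (e d) * F (v(p := e c, q := e d)))"
      by (subst sum.swap, rule sum.cong[OF refl], rule sum.swap)
    also have "\<dots> = (\<Sum>c<k. \<Sum>d<k. (\<Sum>a<k. b (inv g (e a)) (e c) * b (inv g (e a)) (e d)) *
        F (v(p := e c, q := e d)))"
      by (simp only: sum_distrib_right)
    also have "\<dots> = (\<Sum>c<k. \<Sum>d<k. (if c = d then F (v(p := e c, q := e d)) else 0))"
      by (intro sum.cong refl) (simp add: gram)
    also have "\<dots> = trace_form p q F v"
      by (simp add: trace_form_def)
    finally show ?thesis .
  qed
qed

text \<open>
  Put \<open>e a\<close> into slot \<open>q\<close> of \<open>infinitesimal_rotation\<close>, multiply by \<open>b (v q) (e c)\<close>, and sum over \<open>a\<close> and \<open>c\<close>.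
  The summand of \<open>q\<close> itself becomes \<open>(k - 1) F\<close>. For \<open>p \<noteq> q\<close>, the two terms become the
  transposition of \<open>p\<close> and \<open>q\<close> and the contraction of \<open>F\<close> in these slots.
\<close>

lemma star_sum_identity:
  assumes F: "F \<in> invariant_forms P" and fin: "finite P" and q: "q \<in> P"
  shows "(\<Sum>p\<in>P - {q}. F (v \<circ> transpose p q)) - of_int (1 - int k) * F v =
    (\<Sum>p\<in>P - {q}. b (v p) (v q) * trace_form p q F v)"
proof -
  note lin = invariant_formsD(1)[OF F]
  define T where "T p a c = b ((v(q := e a)) p) (e a) * F (v(q := e a, p := e c))
    - b ((v(q := e a)) p) (e c) * F (v(q := e a, p := e a))" for p a c
  have "(\<Sum>p\<in>P. T p a c) = 0" if "a < k" "c < k" for a c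
    unfolding T_def using infinitesimal_rotation[OF F fin that, of "v(q := e a)"] .
  then have "0 = (\<Sum>c<k. \<Sum>a<k. b (v q) (e c) * (\<Sum>p\<in>P. T p a c))"
    by simp
  also have "\<dots> = (\<Sum>p\<in>P. \<Sum>c<k. \<Sum>a<k. b (v q) (e c) * T p a c)"
    unfolding sum_distrib_left by (subst (2) sum.swap, subst sum.swap) simp
  also have "\<dots> = (\<Sum>c<k. \<Sum>a<k. b (v q) (e c) * T q a c) +
      (\<Sum>p\<in>P - {q}. \<Sum>c<k. \<Sum>a<k. b (v q) (e c) * T p a c)"
    using fin q by (rule sum.remove)
  also have "(\<Sum>c<k. \<Sum>a<k. b (v q) (e c) * T q a c) = (of_nat k - 1) * F v"
  proof -
    have "(\<Sum>a<k. b (v q) (e c) * T q a c) = (of_nat k - 1) * (b (v q) (e c) * F (v(q := e c)))"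
      if c: "c < k" for c
    proof -
      have "T q a c = F (v(q := e c)) - (if a = c then F (v(q := e c)) else 0)" if "a < k" for a
        using orthonormal that c by (auto simp: T_def)
      then have "(\<Sum>a<k. T q a c) = (\<Sum>a<k. F (v(q := e c)) - (if a = c then F (v(q := e c)) else 0))"
        by (intro sum.cong) auto
      also have "\<dots> = (of_nat k - 1) * F (v(q := e c))"
        using c by (simp add: sum_subtractf algebra_simps)
      finally show ?thesis by (simp add: sum_distrib_left[symmetric])
    qed
    then show ?thesis using slot_expand[OF lin q, of v] by (simp add: sum_distrib_left)
  qed
  also have "(\<Sum>p\<in>P - {q}. \<Sum>c<k. \<Sum>a<k. b (v q) (e c) * T p a c) =
      (\<Sum>p\<in>P - {q}. F (v \<circ> transpose p q) - b (v p) (v q) * trace_form p q F v)"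
  proof (rule sum.cong[OF refl])
    fix p assume "p \<in> P - {q}"
    then have p: "p \<in> P" "p \<noteq> q" by auto
    have T: "T p a c = b (v p) (e a) * F (v(q := e a, p := e c)) - b (v p) (e c) * F (v(p := e a, q := e a))"
      for a c using p(2) by (simp add: T_def fun_upd_twist[of p q])
    have "F (v \<circ> transpose p q) = F (v(q := v p, p := v q))"
      by (intro arg_cong[of _ _ F]) (auto simp: transpose_def)
    also have "\<dots> = (\<Sum>c<k. b (v q) (e c) * F (v(q := v p, p := e c)))"
      using slot_expand[OF lin p(1), of "v(q := v p, p := v q)"] by simp
    also have "\<dots> = (\<Sum>c<k. b (v q) (e c) * (\<Sum>a<k. b (v p) (e a) * F (v(q := e a, p := e c))))"
      using p(2) by (intro sum.cong refl) (subst slot_expand[OF lin q], simp add: fun_upd_twist[of p q])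
    finally have 1: "F (v \<circ> transpose p q) =
        (\<Sum>c<k. \<Sum>a<k. b (v q) (e c) * (b (v p) (e a) * F (v(q := e a, p := e c))))"
      by (simp add: sum_distrib_left)
    have 2: "b (v p) (v q) * trace_form p q F v =
        (\<Sum>c<k. \<Sum>a<k. b (v q) (e c) * (b (v p) (e c) * F (v(p := e a, q := e a))))"
      unfolding form_expand[of "v p" "v q"] trace_form_def sum_product by (simp add: mult_ac)
    show "(\<Sum>c<k. \<Sum>a<k. b (v q) (e c) * T p a c) =
        F (v \<circ> transpose p q) - b (v p) (v q) * trace_form p q F v"
      unfolding 1 2 by (simp add: T sum_subtractf algebra_simps)
  qed
  finally show ?thesis by (simp add: sum_subtractf algebra_simps)
qed

lemma antisymmetrize_word_zero:
  assumes "finite K" "\<not> inj_on v K"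
  shows "antisymmetrize K F v = 0"
proof -
  obtain p q where pq: "p \<in> K" "q \<in> K" "p \<noteq> q" "v p = v q"
    using assms(2) by (auto simp: inj_on_def)
  have "v \<circ> transpose p q = v" using pq(4) by (auto simp: transpose_def)
  then show ?thesis using antisymmetrize_transpose[OF assms(1) pq(1-3), of F v] by simp
qed

text \<open>
  On words in the \<open>k\<close> basis vectors, two of the slots in \<open>K\<close> carry the same vector.
\<close>

lemma antisymmetrize_zero:
  assumes F: "multilinear_on P F" and "finite P" "K \<subseteq> P" "k < card K"
  shows "antisymmetrize K F v = 0"
proof (rule multilinear_on_eq_zeroI[OF _ assms(2)])
  show "multilinear_on P (antisymmetrize K F)"
    unfolding antisymmetrize_def
    using subspace_sum_fun[OF subspace_multilinear_on[of P], of "{\<sigma>. \<sigma> permutes K}"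
        "\<lambda>\<sigma> v. of_int (sign \<sigma>) * F (v \<circ> \<sigma>)"]
      subspace_times[OF subspace_multilinear_on[of P]] multilinear_on_permute[OF F]
      permutes_subset[OF _ assms(3)] by simp
  fix J assume J: "\<And>i. i \<in> P \<Longrightarrow> J i < k"
  have finK: "finite K" using assms(2,3) finite_subset by blast
  have "\<not> inj_on J K"
  proof
    assume "inj_on J K"
    then have "card K \<le> card {..<k}" using J assms(3) by (intro card_inj_on_le[of J]) auto
    then show False using assms(4) by simp
  qed
  then have "\<not> inj_on (\<lambda>i. e (J i)) K" unfolding inj_on_def by metis
  then show "antisymmetrize K F (\<lambda>i. e (J i)) = 0" by (rule antisymmetrize_word_zero[OF finK])
qed

text \<open>
  An alternating form of as many vectors as the dimension is a multiple of the determinant, and the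
  reflection in one basis vector changes its sign.
\<close>

lemma antisymmetrize_full_zero:
  assumes F: "F \<in> invariant_forms P" and "finite P" "card P = k" "k > 0"
  shows "antisymmetrize P F v = 0"
proof -
  have G: "antisymmetrize P F \<in> invariant_forms P"
    by (rule invariant_forms_antisymmetrize[OF F subset_refl])
  show ?thesis
  proof (rule multilinear_on_eq_zeroI[OF invariant_formsD(1)[OF G] assms(2)])
    fix J assume J: "\<And>i. i \<in> P \<Longrightarrow> J i < k"
    let ?v = "\<lambda>i. e (J i)"
    show "antisymmetrize P F ?v = 0"
    proof (cases "inj_on J P")
      case False
      then have "\<not> inj_on ?v P" unfolding inj_on_def by metis
      then show ?thesis by (rule antisymmetrize_word_zero[OF assms(2)])
    next
      case True
      obtain p where p: "p \<in> P" using assms(3,4) by fastforce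
      let ?g = "\<lambda>x. x - (2 * b x (e (J p))) *s e (J p)"
      have g: "?g (e (J i)) = (if i = p then - 1 *s e (J p) else e (J i))" if "i \<in> P" for i
      proof -
        have "b (e (J i)) (e (J p)) = (if i = p then 1 else 0)"
          using orthonormal[OF J[OF that] J[OF p]] inj_onD[OF True _ that p] by auto
        moreover have "e (J p) - 2 *s e (J p) = - 1 *s e (J p)"
          using scale_left_diff_distrib[of 1 2 "e (J p)"] by simp
        ultimately show ?thesis by simp
      qed
      have "antisymmetrize P F ?v = antisymmetrize P F (\<lambda>i. ?g (?v i))"
        using invariant_formsD(2)[OF G reflection_orthogonal[OF J[OF p]], of ?v] by simp
      also have "\<dots> = antisymmetrize P F (?v(p := - 1 *s e (J p)))"
        using g by (intro multilinear_onD(1)[OF invariant_formsD(1)[OF G]]) auto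
      also have "\<dots> = - antisymmetrize P F (?v(p := e (J p)))"
        using multilinear_onD(3)[OF invariant_formsD(1)[OF G] p, of ?v "-1" "e (J p)"] by simp
      also have "?v(p := e (J p)) = ?v" by auto
      finally show ?thesis by simp
    qed
  qed
qed

theorem first_fundamental_theorem:
  assumes "finite P"
  shows "invariant_forms P \<subseteq> matching_span P"
  using assms
proof (induction "card P" arbitrary: P rule: less_induct)
  case less
  note sub = subspace_matching_span[of P]
  show ?case
  proof (cases "P = {}")
    case True
    show ?thesis
    proof
      fix F assume F: "F \<in> invariant_forms P"
      have "F v = F (\<lambda>i. 0) * diagram_form b {#} v" for v
        using multilinear_onD(1)[OF invariant_formsD(1)[OF F], of v "\<lambda>i. 0"] True
        by (simp add: diagram_form_empty)
      moreover have "diagram_form b {#} \<in> matching_span P"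
        unfolding matching_span_def using True by (intro forms.span_base) (simp add: matching_empty_iff)
      ultimately show "F \<in> matching_span P"
        using subspace_times[OF sub, of "diagram_form b {#}" "F (\<lambda>i. 0)"] by (metis (no_types, lifting) ext)
    qed
  next
    case False
    show ?thesis
    proof (rule star_sums_force_membership[OF less.prems False sub, of _ "1 - int k" k])
      show "antisymmetrize K F \<in> invariant_forms P" if "F \<in> invariant_forms P" "K \<subseteq> P" for F K
        using that by (rule invariant_forms_antisymmetrize)
      show "(\<lambda>v. (\<Sum>p\<in>P - {q}. F (v \<circ> transpose p q)) - of_int (1 - int k) * F v) \<in> matching_span P"
        if F: "F \<in> invariant_forms P" and q: "q \<in> P" for F q
        unfolding star_sum_identity[OF F less.prems q]
      proof (intro subspace_sum_fun sub contraction_times_matching_span)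
        fix p assume "p \<in> P - {q}"
        then have p: "p \<in> P" "p \<noteq> q" by auto
        have "card (P - {p, q}) < card P" using p q less.prems by (intro psubset_card_mono) auto
        then have "invariant_forms (P - {p, q}) \<subseteq> matching_span (P - {p, q})"
          using less.prems by (intro less.hyps) auto
        then show "trace_form p q F \<in> matching_span (P - {p, q})"
          using trace_form_invariant[OF F p(1) q p(2)] by blast
      qed (use q in auto)
      show "antisymmetrize K F \<in> matching_span P"
        if "F \<in> invariant_forms P" "K \<subseteq> P" "card K = Suc k" for F K
        using antisymmetrize_zero[OF invariant_formsD(1)[OF that(1)] less.prems that(2)] that(3)
          subspace_zero[OF sub] by (simp add: fun_eq_iff[of "antisymmetrize K F" "\<lambda>_. 0", THEN iffD2])
      show "antisymmetrize P F \<in> matching_span P" if "F \<in> invariant_forms P" "card P = k" for F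
      proof -
        have "k > 0" using that(2) False less.prems card_gt_0_iff by blast
        then show ?thesis
          using antisymmetrize_full_zero[OF that(1) less.prems that(2)]
            subspace_zero[OF sub] by (simp add: fun_eq_iff[of "antisymmetrize P F" "\<lambda>_. 0", THEN iffD2])
      qed
    qed simp
  qed
qed

end


section \<open>Straightening and linear independence\<close>

lemma nesting_diagrams_eq:
  "nesting_diagrams k n = {D. matching {1..n} D \<and> decomposable_into_weak_nestings k D}"
  by (simp add: nesting_diagrams_def one_regular_iff_matching)

lemma transp_on_less_partner: "transp_on A (\<lambda>D D'. less_fun (partner D) (partner D'))"
  by (rule transp_onI) (rule less_fun_trans)

lemma asymp_on_less_partner: "asymp_on A (\<lambda>D D'. less_fun (partner D) (partner D'))"
  by (rule asymp_onI) (rule less_fun_asym)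

context orthonormal_frame
begin

text \<open>
  The right ends \<open>?K\<close> of \<open>k + 1\<close> arcs that are pairwise not nested are more slots than the dimension, so
  antisymmetrizing over them yields a linear relation. Its other terms are larger matchings by
  \<open>relabel_increases\<close>.
\<close>

lemma straightening:
  assumes D: "matching P D" and fin: "finite P" and nd: "\<not> decomposable_into_weak_nestings k D"
    and S: "forms.subspace S"
    and larger: "\<And>D'. matching P D' \<Longrightarrow> less_fun (partner D) (partner D') \<Longrightarrow> diagram_form b D' \<in> S"
  shows "diagram_form b D \<in> S"
proof -
  obtain C where C: "C \<subseteq> set_mset D" "pairwise_unnested C" "k < card C"
    using decomposable_if_unnested_sets_small[OF D, of k] nd by (meson not_less)
  let ?K = "snd ` C"
  have "inj_on snd C"
  proof (rule inj_onI)
    fix a a' assume "a \<in> C" "a' \<in> C" "snd a = snd a'"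
    then show "a = a'" using C(1) matching_arc_unique[OF D, of a a' "snd a"] by auto
  qed
  then have card: "k < card ?K" using C(3) by (simp add: card_image)
  have KP: "?K \<subseteq> P" using C(1) matching_arc(3)[OF D] by auto
  have finK: "finite ?K" using KP fin finite_subset by blast
  let ?perms = "{\<tau>. \<tau> permutes ?K}"
  have "diagram_form b D v =
      (\<Sum>\<tau>\<in>?perms - {id}. (- of_int (sign \<tau>)) * diagram_form b (relabel \<tau> D) v)" for v
  proof -
    have "0 = antisymmetrize ?K (diagram_form b D) v"
      using antisymmetrize_zero[OF invariant_formsD(1)[OF diagram_form_invariant[OF D]] fin KP card]
      by simp
    also have "\<dots> = (\<Sum>\<tau>\<in>?perms. of_int (sign \<tau>) * diagram_form b (relabel \<tau> D) v)"
      by (simp add: antisymmetrize_def diagram_form_relabel)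
    also have "\<dots> = of_int (sign (id :: nat \<Rightarrow> nat)) * diagram_form b (relabel id D) v +
        (\<Sum>\<tau>\<in>?perms - {id}. of_int (sign \<tau>) * diagram_form b (relabel \<tau> D) v)"
      by (rule sum.remove[OF finite_permutations[OF finK]]) (simp add: permutes_id)
    finally show ?thesis
      by (simp add: diagram_form_relabel sum_negf eq_neg_iff_add_eq_0)
  qed
  moreover have "(\<lambda>v. \<Sum>\<tau>\<in>?perms - {id}. (- of_int (sign \<tau>)) * diagram_form b (relabel \<tau> D) v) \<in> S"
  proof (intro subspace_sum_fun subspace_times S)
    fix \<tau> assume "\<tau> \<in> ?perms - {id}"
    then have \<tau>: "\<tau> permutes ?K" "\<tau> \<noteq> id" by auto
    show "diagram_form b (relabel \<tau> D) \<in> S"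
      using relabel_increases[OF D C(1,2) \<tau>] matching_relabel[OF D permutes_subset[OF \<tau>(1) KP]]
      by (intro larger)
  qed
  ultimately show ?thesis by (metis (no_types, lifting) ext)
qed

text \<open>
  A lexicographically largest exception would contradict \<open>straightening\<close>.
\<close>

theorem nesting_diagrams_span:
  assumes "matching {1..n} D"
  shows "diagram_form b D \<in> forms.span (diagram_form b ` nesting_diagrams k n)"
proof (rule ccontr)
  let ?S = "forms.span (diagram_form b ` nesting_diagrams k n)"
  let ?bad = "{D. matching {1..n} D \<and> diagram_form b D \<notin> ?S}"
  assume "diagram_form b D \<notin> ?S"
  then have "?bad \<noteq> {}" using assms by blast
  moreover have "finite ?bad" using finite_matchings[of "{1..n}"] by (rule rev_finite_subset) auto
  ultimately obtain M where M: "M \<in> ?bad"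
    and max: "\<forall>D\<in>?bad. D \<noteq> M \<longrightarrow> \<not> less_fun (partner M) (partner D)"
    using Finite_Set.bex_max_element[OF _ asymp_on_less_partner transp_on_less_partner] by blast
  have "\<not> decomposable_into_weak_nestings k M"
  proof
    assume "decomposable_into_weak_nestings k M"
    then have "diagram_form b M \<in> ?S"
      using M by (intro forms.span_base) (simp add: nesting_diagrams_eq)
    then show False using M by simp
  qed
  moreover have "diagram_form b D' \<in> ?S"
    if "matching {1..n} D'" "less_fun (partner M) (partner D')" for D'
  proof (rule ccontr)
    assume "diagram_form b D' \<notin> ?S"
    then have "D' \<in> ?bad" using that(1) by simp
    moreover have "D' \<noteq> M" using that(2) less_fun_irrefl by auto
    ultimately show False using max that(2) by simp
  qed
  ultimately have "diagram_form b M \<in> ?S"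
    using M by (intro straightening[of "{1..n}" M] forms.subspace_span) auto
  then show False using M by blast
qed

lemma diagram_form_word:
  assumes f: "\<And>i j. (i, j) \<in># D \<Longrightarrow> f i < k \<and> f j < k"
  shows "diagram_form b D (\<lambda>i. e (f i)) = of_bool (\<forall>(i, j) \<in># D. f i = f j)"
  using f
proof (induction D)
  case (add a D)
  obtain i j where a: "a = (i, j)" by fastforce
  have "f i < k" "f j < k" using add.prems[of i j] by (auto simp: a)
  then have "b (e (f i)) (e (f j)) = of_bool (f i = f j)" by (simp add: orthonormal)
  moreover have "diagram_form b D (\<lambda>i. e (f i)) = of_bool (\<forall>(i, j) \<in># D. f i = f j)"
    using add.prems by (intro add.IH) auto
  ultimately show ?case by (simp add: a diagram_form_add_mset)
qed (simp add: diagram_form_empty)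

text \<open>
  Evaluate at the word \<open>\<lambda>i. e (f i)\<close>, where \<open>f\<close> colours the vertices by the nestings of the smallest
  matching \<open>M\<close> with nonzero coefficient. Matchings with a nonzero value are at most \<open>M\<close>, so only the
  coefficient of \<open>M\<close> survives.
\<close>

theorem nesting_diagrams_linearly_independent:
  assumes S: "S \<subseteq> nesting_diagrams k n" "finite S"
    and zero: "\<And>v. (\<Sum>D\<in>S. c D * diagram_form b D v) = 0" and "D \<in> S"
  shows "c D = 0"
proof (rule ccontr)
  assume "c D \<noteq> 0"
  let ?T = "{D \<in> S. c D \<noteq> 0}"
  have "?T \<noteq> {}" using \<open>D \<in> S\<close> \<open>c D \<noteq> 0\<close> by blast
  moreover have "finite ?T" using S(2) by simp
  ultimately obtain M where M: "M \<in> ?T"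
    and min: "\<forall>D\<in>?T. D \<noteq> M \<longrightarrow> \<not> less_fun (partner D) (partner M)"
    using Finite_Set.bex_min_element[OF _ asymp_on_less_partner transp_on_less_partner] by blast
  have mat: "matching {1..n} D" "decomposable_into_weak_nestings k D" if "D \<in> S" for D
    using S(1) that by (auto simp: nesting_diagrams_eq)
  have MS: "M \<in> S" using M by simp
  obtain f where f: "\<And>x. x \<in> {1..n} \<Longrightarrow> f x < k" "\<And>i j. (i, j) \<in># M \<Longrightarrow> f i = f j"
    "\<And>a a'. a \<in># M \<Longrightarrow> a' \<in># M \<Longrightarrow> f (fst a) = f (fst a') \<Longrightarrow> weakly_nested a a'"
    using decomposable_colouring[OF mat[OF MS]] by blast
  have val: "diagram_form b D (\<lambda>i. e (f i)) = of_bool (\<forall>(i, j) \<in># D. f i = f j)" if "D \<in> S" for D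
    using f(1) matching_arc[OF mat(1)[OF that]] by (intro diagram_form_word) auto
  have off: "c D * diagram_form b D (\<lambda>i. e (f i)) = 0" if "D \<in> S - {M}" for D
  proof (cases "c D = 0")
    case False
    have "\<not> (\<forall>(i, j) \<in># D. f i = f j)"
    proof
      assume "\<forall>(i, j) \<in># D. f i = f j"
      then have "less_fun (partner D) (partner M)"
        using that f by (intro nested_matching_is_largest[OF mat(1)[OF MS] mat(1), of D f]) auto
      then show False using min that False by simp
    qed
    then show ?thesis using val[of D] that by auto
  qed simp
  have rest: "(\<Sum>D\<in>S - {M}. c D * diagram_form b D (\<lambda>i. e (f i))) = 0"
    by (intro sum.neutral ballI off)
  have "0 = (\<Sum>D\<in>S. c D * diagram_form b D (\<lambda>i. e (f i)))" using zero by simp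
  also have "\<dots> = c M * diagram_form b M (\<lambda>i. e (f i))"
    using rest by (simp add: sum.remove[OF S(2) MS])
  also have "\<dots> = c M" using val[OF MS] f(2) by auto
  finally show False using M by simp
qed

lemma inj_on_diagram_form: "inj_on (diagram_form b) (nesting_diagrams k n)"
proof (rule inj_onI, rule ccontr)
  fix D D' assume D: "D \<in> nesting_diagrams k n" "D' \<in> nesting_diagrams k n"
    and eq: "diagram_form b D = diagram_form b D'" and ne: "D \<noteq> D'"
  have "(if D = D then 1 else - 1 :: complex) = 0"
    by (rule nesting_diagrams_linearly_independent[of "{D, D'}" n "\<lambda>E. if E = D then 1 else - 1" D])
      (use D eq ne in auto)
  then show False by simp
qed

lemma nesting_diagrams_independent:
  "\<not> forms.dependent (diagram_form b ` nesting_diagrams k n)"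
  unfolding forms.independent_explicit_finite_subsets
proof (intro allI impI ballI)
  fix A u F
  assume A: "A \<subseteq> diagram_form b ` nesting_diagrams k n" "finite A"
    and zero: "(\<Sum>F\<in>A. scale_form (u F) F) = 0" and F: "F \<in> A"
  obtain S where S: "S \<subseteq> nesting_diagrams k n" "finite S" "A = diagram_form b ` S"
    using finite_subset_image[OF A(2,1)] by blast
  have inj: "inj_on (diagram_form b) S" using inj_on_diagram_form S(1) by (rule inj_on_subset)
  have "(\<Sum>D\<in>S. u (diagram_form b D) * diagram_form b D v) = 0" for v
  proof -
    have "(\<Sum>D\<in>S. u (diagram_form b D) * diagram_form b D v) = (\<Sum>F\<in>A. scale_form (u F) F) v"
      unfolding S(3) sum.reindex[OF inj] by (simp add: sum_fun_apply scale_form_def)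
    then show ?thesis by (simp add: zero)
  qed
  moreover obtain D where "D \<in> S" "F = diagram_form b D" using F S(3) by blast
  ultimately show "u F = 0"
    using nesting_diagrams_linearly_independent[OF S(1,2), of "\<lambda>D. u (diagram_form b D)" D] by simp
qed

lemma span_nesting_diagrams:
  "forms.span (diagram_form b ` nesting_diagrams k n) = tensor_invariants scale b n"
proof
  show "forms.span (diagram_form b ` nesting_diagrams k n) \<subseteq> tensor_invariants scale b n"
    unfolding tensor_invariants_eq
    by (rule forms.span_minimal[OF _ subspace_invariant_forms])
      (auto simp: nesting_diagrams_eq diagram_form_invariant)
  have "invariant_forms {1..n} \<subseteq> matching_span {1..n}" by (rule first_fundamental_theorem) simp
  also have "\<dots> \<subseteq> forms.span (diagram_form b ` nesting_diagrams k n)"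
    unfolding matching_span_def
    by (rule forms.span_minimal) (auto simp: nesting_diagrams_span)
  finally show "tensor_invariants scale b n \<subseteq> forms.span (diagram_form b ` nesting_diagrams k n)"
    unfolding tensor_invariants_eq .
qed

text \<open>
  For even \<open>n\<close>, the form of any perfect matching is \<open>1\<close> at the constant word \<open>e 0\<close>. For odd \<open>n\<close>, the
  orthogonal map \<open>- id\<close> multiplies every form by \<open>-1\<close>.
\<close>

lemma invariants_nonzero_iff_even:
  assumes "k > 0"
  shows "tensor_invariants scale b n \<noteq> {0} \<longleftrightarrow> even n"
proof
  assume "even n"
  then obtain D where D: "matching {1..n} D" using ex_matching by blast
  have "diagram_form b D (\<lambda>i. e 0) = 1"
    using diagram_form_word[of D "\<lambda>_. 0"] assms by simp
  then have "diagram_form b D \<noteq> 0" by (metis zero_fun_apply zero_neq_one)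
  then show "tensor_invariants scale b n \<noteq> {0}"
    using diagram_form_invariant[OF D] by (auto simp: tensor_invariants_eq)
next
  assume ne: "tensor_invariants scale b n \<noteq> {0}"
  show "even n"
  proof (rule ccontr)
    assume odd: "odd n"
    have "F = 0" if F: "F \<in> invariant_forms {1..n}" for F
    proof
      fix v
      have "F v = F (\<lambda>i. - 1 *s v i)" using invariant_formsD(2)[OF F uminus_orthogonal, of v] by simp
      also have "\<dots> = - F v"
        using multilinear_homogeneous[OF invariant_formsD(1)[OF F], of "-1" v] odd by simp
      finally show "F v = 0 v" by simp
    qed
    moreover have "0 \<in> invariant_forms {1..n}"
      using subspace_invariant_forms forms.subspace_0 by blast
    ultimately have "invariant_forms {1..n} = {0}" by blast
    then show False using ne by (simp add: tensor_invariants_eq)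
  qed
qed

end

theorem proposition4p3p2:
  fixes scale :: "complex \<Rightarrow> 'v::ab_group_add \<Rightarrow> 'v"
    and b :: "'v \<Rightarrow> 'v \<Rightarrow> complex"
    and k n :: nat
  assumes "symmetric_bilinear_space scale b"
    and "vector_space.dim scale (UNIV :: 'v set) = k"
  shows "(k > 0 \<longrightarrow> (tensor_invariants scale b n \<noteq> {0} \<longleftrightarrow> even n)) \<and>
    (even n \<longrightarrow>
      inj_on (diagram_form b) (nesting_diagrams k n) \<and>
      \<not> module.dependent scale_form (diagram_form b ` nesting_diagrams k n) \<and>
      module.span scale_form (diagram_form b ` nesting_diagrams k n) = tensor_invariants scale b n)"
proof -
  interpret symmetric_bilinear_space scale b by (fact assms(1))
  have "\<exists>e. orthonormal_frame scale b k e"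
  proof (rule ex_orthonormal_frame)
    fix e assume "\<And>i j. i < dim UNIV \<Longrightarrow> j < dim UNIV \<Longrightarrow> b (e i) (e j) = (if i = j then 1 else 0)"
      "\<And>x. x = (\<Sum>a<dim UNIV. scale (b x (e a)) (e a))"
    then have "orthonormal_frame scale b k e" unfolding assms(2) by unfold_locales
    then show ?thesis by blast
  qed
  then obtain e where "orthonormal_frame scale b k e" by blast
  then interpret orthonormal_frame scale b k e .
  show ?thesis
    by (intro conjI impI invariants_nonzero_iff_even inj_on_diagram_form
        nesting_diagrams_independent span_nesting_diagrams)
qed

end
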